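(* Let $\mathcal{S}$ be a bounded measurable set in $d$-dimensional Euclidean space. Let $p_k(n^d)$ be the probability that no two copies intersect when we place $k$ copies of $\mathcal{S}$ independently and uniformly at random inside a $d$-dimensional torus of side length $n$. Then $n^{dk}p_k(n^d)$ is eventually (for all sufficiently large $n$) a polynomial in $n^d$ for each $k$, and these polynomials form a sequence of binomial type.
   Context: The $d$-dimensional torus of side length $n$ is $\mathbb{R}^d/(n\mathbb{Z})^d$. A random copy of $\mathcal{S}$ is the image in this torus of a translate $t+\mathcal{S}$, with $t$ uniformly distributed on the torus; the $k$ copies use independent translations. Two copies intersect if they have a common point. A sequence of polynomials $P_0,P_1,P_2,\dots$ is of binomial type if $P_0=1$, $P_i(0)=0$ for $i>0$, and $\left(\sum_{i\ge0}P_i(1)x^i\right)^m=\sum_{i\ge0}P_i(m)x^i$ for all nonnegative $m$; the third condition may equivalently be replaced by $P_k(x+y)=\sum_{i=0}^kP_i(x)P_{k-i}(y)$ for all $k\ge0$. (This convention has no factor $\binom{k}{i}$; a sequence $P_i$ is of binomial type in this sense iff $i!\,P_i$ is of binomial type in the traditional sense.)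
   Formalization: Binomial type (in the convention without binomial factors) is proved for the polynomials divided by k!, since undivided it fails for every S (e.g. S empty gives V^k); the probability is read as outer probability, which agrees with the usual one whenever the event is measurable. *)

theory Defs
  imports
    "HOL-Probability.Probability"
    "HOL-Computational_Algebra.Polynomial"
    "HOL-Computational_Algebra.Formal_Power_Series"
begin

unbundle no fps_syntax

text \<open>The torus of side length \<open>n\<close> is the quotient \<open>UNIV // torus_rel n\<close>; \<open>n\<close> is real.\<close>

definition torus_rel :: "real \<Rightarrow> ((real ^ 'd) \<times> (real ^ 'd)) set" where
  "torus_rel n = {(x, y). \<exists>z :: int ^ 'd. \<forall>i. x $ i - y $ i = n * of_int (z $ i)}"

definition torus_proj :: "real \<Rightarrow> real ^ 'd \<Rightarrow> (real ^ 'd) set" where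
  "torus_proj n x = torus_rel n `` {x}"

definition torus_copy :: "real \<Rightarrow> (real ^ 'd) set \<Rightarrow> real ^ 'd \<Rightarrow> (real ^ 'd) set set" where
  "torus_copy n S t = torus_proj n ` ((\<lambda>x. t + x) ` S)"

text \<open>
  A uniform point of the torus is represented by its unique representative in the half-open cube
  \<open>[0, n)\<^sup>d\<close>; \<open>torus_copy_mod\<close> below shows that the copy depends only on the class of \<open>t\<close>.
\<close>

definition torus_cube :: "real \<Rightarrow> (real ^ 'd) set" where
  "torus_cube n = {x. \<forall>i. 0 \<le> x $ i \<and> x $ i < n}"

definition random_shifts :: "nat \<Rightarrow> real \<Rightarrow> (nat \<Rightarrow> real ^ 'd) measure" where
  "random_shifts k n = (\<Pi>\<^sub>M i\<in>{..<k}. uniform_measure lborel (torus_cube n))"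

definition disjoint_copies_event ::
    "(real ^ 'd) set \<Rightarrow> nat \<Rightarrow> real \<Rightarrow> (nat \<Rightarrow> real ^ 'd) set" where
  "disjoint_copies_event S k n = {t \<in> space (random_shifts k n).
     \<forall>i<k. \<forall>j<k. i \<noteq> j \<longrightarrow> torus_copy n S (t i) \<inter> torus_copy n S (t j) = {}}"

text \<open>
  Two copies intersect iff the difference of their translations lies in \<open>S - S\<close> modulo the
  lattice. For Borel \<open>S\<close> this difference set is analytic, so the event is measurable for the
  completed product measure, but not in general for the product \<open>\<sigma>\<close>-algebra; for Lebesgue
  measurable \<open>S\<close> it need not be measurable at all. The probability is therefore taken as outer
  probability. It is the ordinary probability whenever the event is measurable for the completed
  measure: see \<open>p_disjoint_eq_prob\<close>.
\<close>

definition p_disjoint :: "(real ^ 'd) set \<Rightarrow> nat \<Rightarrow> real \<Rightarrow> real" where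
  "p_disjoint S k n = enn2real (outer_measure_of (random_shifts k n) (disjoint_copies_event S k n))"

text \<open>
  In this convention there is no factor \<open>k choose i\<close>: \<open>P\<close> is of binomial type in the traditional
  sense iff \<open>\<lambda>k. smult (1 / fact k) (P k)\<close> is of binomial type in the sense below. Placements of
  \<open>k\<close> labelled copies are of binomial type in the traditional sense only, e.g. \<open>\<lambda>k. monom 1 k\<close> for
  \<open>S = {}\<close>: see \<open>p_disjoint_empty\<close> and \<open>not_binomial_type_monom\<close>.
\<close>

definition binomial_type :: "(nat \<Rightarrow> real poly) \<Rightarrow> bool" where
  "binomial_type P \<longleftrightarrow>
     P 0 = 1 \<and>
     (\<forall>i>0. poly (P i) 0 = 0) \<and>
     (\<forall>m :: nat. Abs_fps (\<lambda>i. poly (P i) 1) ^ m = Abs_fps (\<lambda>i. poly (P i) (of_nat m)))"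

lemma equiv_torus_rel: "equiv UNIV (torus_rel n :: ((real ^ 'd) \<times> (real ^ 'd)) set)"
proof (rule equivI)
  show "refl (torus_rel n :: ((real ^ 'd) \<times> (real ^ 'd)) set)"
    by (auto simp: refl_on_def torus_rel_def intro!: exI[of _ 0])
  show "sym (torus_rel n :: ((real ^ 'd) \<times> (real ^ 'd)) set)"
  proof (rule symI)
    fix x y :: "real ^ 'd" assume "(x, y) \<in> torus_rel n"
    then obtain z :: "int ^ 'd" where z: "\<And>i. x $ i - y $ i = n * of_int (z $ i)"
      unfolding torus_rel_def by blast
    have "\<forall>i. y $ i - x $ i = n * of_int ((- z) $ i)"
    proof
      fix i show "y $ i - x $ i = n * of_int ((- z) $ i)" using z[of i] by simp
    qed
    then show "(y, x) \<in> torus_rel n" unfolding torus_rel_def by blast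
  qed
  show "trans (torus_rel n :: ((real ^ 'd) \<times> (real ^ 'd)) set)"
  proof (rule transI)
    fix x y w :: "real ^ 'd" assume "(x, y) \<in> torus_rel n" "(y, w) \<in> torus_rel n"
    then obtain u v :: "int ^ 'd" where u: "\<And>i. x $ i - y $ i = n * of_int (u $ i)"
      and v: "\<And>i. y $ i - w $ i = n * of_int (v $ i)"
      unfolding torus_rel_def by blast
    have "\<forall>i. x $ i - w $ i = n * of_int ((u + v) $ i)"
    proof
      fix i show "x $ i - w $ i = n * of_int ((u + v) $ i)"
        using u[of i] v[of i] by (simp add: distrib_left)
    qed
    then show "(x, w) \<in> torus_rel n" unfolding torus_rel_def by blast
  qed
qed auto

lemma torus_copy_mod:
  fixes s t :: "real ^ 'd"
  assumes "(s, t) \<in> torus_rel n"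
  shows "torus_copy n S s = torus_copy n S t"
proof -
  have "(s + x, t + x) \<in> torus_rel n" for x
    using assms by (simp add: torus_rel_def)
  then have "torus_proj n (s + x) = torus_proj n (t + x)" for x
    unfolding torus_proj_def by (rule equiv_class_eq[OF equiv_torus_rel])
  then show ?thesis by (simp add: torus_copy_def image_image)
qed

lemma outer_measure_of_completion:
  assumes "A \<in> sets (completion M)"
  shows "outer_measure_of M A = emeasure (completion M) A"
proof (rule antisym)
  obtain B where B: "B \<in> sets M" "A \<subseteq> B" "emeasure (completion M) A = emeasure M B"
    using completion_upper[OF assms] by metis
  show "outer_measure_of M A \<le> emeasure (completion M) A"
    unfolding outer_measure_of_def B(3) by (rule INF_lower) (use B in auto)
  show "emeasure (completion M) A \<le> outer_measure_of M A"
    unfolding outer_measure_of_def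
  proof (rule INF_greatest)
    fix C assume "C \<in> {B \<in> sets M. A \<subseteq> B}"
    then show "emeasure (completion M) A \<le> emeasure M C"
      using emeasure_mono[of A C "completion M"] by simp
  qed
qed

lemma p_disjoint_eq_prob:
  assumes "disjoint_copies_event S k n \<in> sets (completion (random_shifts k n))"
  shows "p_disjoint S k n = measure (completion (random_shifts k n)) (disjoint_copies_event S k n)"
  unfolding p_disjoint_def outer_measure_of_completion[OF assms] measure_def ..

lemma emeasure_torus_cube:
  assumes "n \<ge> 0"
  shows "emeasure lborel (torus_cube n :: (real ^ 'd) set) = ennreal (n ^ CARD('d))"
proof -
  have "AE x in lborel. \<forall>i. (x :: real ^ 'd) $ i \<noteq> n"
  proof -
    have "AE x in lborel. (x :: real ^ 'd) $ i \<noteq> n" for i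
    proof -
      have "negligible {x :: real ^ 'd. axis i 1 \<bullet> x = n}"
        by (rule negligible_hyperplane) simp
      then have "{x :: real ^ 'd. axis i 1 \<bullet> x = n} \<in> null_sets lborel"
        by (simp add: negligible_iff_null_sets null_sets_completion_iff)
      from AE_not_in[OF this] show ?thesis by (simp add: inner_axis')
    qed
    then show ?thesis by (simp add: AE_all_countable)
  qed
  moreover have "(torus_cube n :: (real ^ 'd) set) \<in> sets lborel"
    unfolding torus_cube_def by measurable
  ultimately have "emeasure lborel (torus_cube n :: (real ^ 'd) set)
      = emeasure lborel (cbox 0 ((\<chi> i. n) :: real ^ 'd))"
    by (intro emeasure_eq_AE) (auto elim!: eventually_mono simp: torus_cube_def mem_box_cart less_le)
  also have "\<dots> = ennreal (\<Prod>b\<in>(Basis :: (real ^ 'd) set). (((\<chi> i. n) :: real ^ 'd) - 0) \<bullet> b)"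
    using assms by (intro emeasure_lborel_cbox) (auto simp: Basis_vec_def inner_axis)
  also have "(\<Prod>b\<in>(Basis :: (real ^ 'd) set). (((\<chi> i. n) :: real ^ 'd) - 0) \<bullet> b)
      = (\<Prod>b\<in>(Basis :: (real ^ 'd) set). n)"
    by (intro prod.cong) (auto simp: Basis_vec_def inner_axis)
  also have "\<dots> = n ^ CARD('d)" by simp
  finally show ?thesis .
qed

lemma prob_space_random_shifts:
  assumes "n > 0"
  shows "prob_space (random_shifts k n :: (nat \<Rightarrow> real ^ 'd) measure)"
proof -
  have e: "emeasure lborel (torus_cube n :: (real ^ 'd) set) = ennreal (n ^ CARD('d))"
    using assms by (intro emeasure_torus_cube) simp
  have "0 < n ^ CARD('d)" using assms by simp
  then have "prob_space (uniform_measure lborel (torus_cube n :: (real ^ 'd) set))"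
    by (intro prob_space_uniform_measure) (simp_all only: e ennreal_eq_0_iff ennreal_neq_top not_le not_False_eq_True infinity_ennreal_def)
  then show ?thesis
    unfolding random_shifts_def by (rule prob_space_PiM)
qed

lemma p_disjoint_empty:
  assumes "n > 0"
  shows "p_disjoint ({} :: (real ^ 'd) set) k n = 1"
proof -
  interpret prob_space "random_shifts k n :: (nat \<Rightarrow> real ^ 'd) measure"
    using assms by (rule prob_space_random_shifts)
  have "disjoint_copies_event ({} :: (real ^ 'd) set) k n = space (random_shifts k n)"
    by (auto simp: disjoint_copies_event_def torus_copy_def)
  then show ?thesis by (simp add: p_disjoint_def emeasure_space_1)
qed

lemma not_binomial_type_monom: "\<not> binomial_type (\<lambda>k. monom 1 k)"
proof
  assume "binomial_type (\<lambda>k. monom 1 k)"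
  then have "Abs_fps (\<lambda>i. 1 :: real) ^ 2 = Abs_fps (\<lambda>i. 2 ^ i)"
    unfolding binomial_type_def by (auto simp: poly_monom dest!: spec[of _ 2])
  then have "fps_nth (Abs_fps (\<lambda>i. 1 :: real) ^ 2) 2 = 4" by simp
  then show False by (simp add: power2_eq_square fps_mult_nth)
qed

end

theory Submission
  imports Defs
begin

text \<open>
  Let \<open>h A\<close> indicate that no two of the copies with labels in \<open>A\<close> intersect. If the labels split into
  two groups \<open>X\<close> and \<open>Y\<close> of copies that are far apart, then \<open>h (X \<union> Y) = h X * h Y\<close>. Define truncated
  functions \<open>\<phi>\<close> by \<open>h A = (\<Sum>B. \<phi> B * h (A - B))\<close>, where \<open>B\<close> ranges over the subsets of \<open>A\<close> that contain the
  least label of \<open>A\<close>. The factorization forces \<open>\<phi> A\<close> to vanish unless the copies in \<open>A\<close> form a single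
  cluster (\<open>ursell_eq_0_if_factorizes\<close>).

  Since copies with different labels are independent, integrating the definition of \<open>\<phi>\<close> gives a recursion
  for the probabilities \<open>p\<close>, namely
  \<open>p (k + 1) = (\<Sum>i\<le>k. (k choose i) * q (i + 1) * p (k - i))\<close>, where \<open>q j\<close> is the integral of \<open>\<phi>\<close> over \<open>j\<close>
  copies (\<open>outer_prob_Suc\<close>). A cluster of \<open>j\<close> copies has bounded diameter, so in a large torus it does
  not notice the side length \<open>n\<close>, except that it may be translated over the whole volume \<open>n\<^sup>d\<close>. Hence
  \<open>n\<^bsup>dj\<^esup> q j = c j * n\<^sup>d\<close> with a constant \<open>c j\<close> as soon as \<open>n\<close> is large (\<open>cluster_integral_scaling\<close>). The
  recursion then shows that \<open>n\<^bsup>dk\<^esup> p k\<close> is the value of a polynomial in \<open>n\<^sup>d\<close>. For the generating function of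
  these polynomials, divided by \<open>k!\<close>, it becomes a linear differential equation whose coefficient is
  proportional to the argument, and this yields the binomial type (\<open>binomial_type_cluster_poly\<close>).

  The event that no two copies intersect may fail to be measurable, and then \<open>p\<close> is an outer
  probability, which is not additive. The proof therefore works with the indicator functions of
  measurable hulls of the events. They integrate to the outer probabilities, and the two properties on
  which everything rests survive almost everywhere: a hull of a product is a product of hulls
  (\<open>null_sets_in_Times_measurable_hulls\<close>, \<open>AE_boltzmann_factorizes\<close>), and a hull of a translation
  invariant set is invariant (\<open>AE_boltzmann_invariant\<close>).
\<close>

section \<open>Truncated functions and sequences of binomial type\<close>

text \<open>
  If \<open>h A\<close> indicates that the objects with labels in \<open>A\<close> do not collide, \<open>ursell h A\<close> is its truncated
  (connected) part, also called Ursell function. Recursing on the block \<open>B\<close> that contains \<open>Min A\<close>,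
  instead of summing over all set partitions, keeps every later argument to sums over single subsets.
  The value on infinite sets is a default that lets the recursion terminate.
\<close>

function ursell :: "(nat set \<Rightarrow> real) \<Rightarrow> nat set \<Rightarrow> real" where
  "ursell h A = (if finite A
     then h A - (\<Sum>B\<in>{B. Min A \<in> B \<and> B \<subset> A}. ursell h B * h (A - B)) else 0)"
  by auto
termination
  by (relation "Wellfounded.measure (\<lambda>(h, A). card A)") (auto intro: psubset_card_mono)

declare ursell.simps [simp del]

lemma finite_rooted_subsets: "finite A \<Longrightarrow> finite {B. m \<in> B \<and> B \<subseteq> A}"
  by (rule finite_subset[of _ "Pow A"]) auto

lemma sum_ursell:
  assumes "finite A" "A \<noteq> {}" "h {} = 1"
  shows "h A = (\<Sum>B\<in>{B. Min A \<in> B \<and> B \<subseteq> A}. ursell h B * h (A - B))"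
proof -
  have "{B. Min A \<in> B \<and> B \<subseteq> A} = insert A {B. Min A \<in> B \<and> B \<subset> A}"
    using assms Min_in by auto
  moreover have "finite {B. Min A \<in> B \<and> B \<subset> A}"
    by (rule finite_subset[OF _ finite_rooted_subsets[OF assms(1), of "Min A"]]) auto
  ultimately show ?thesis
    using assms by (simp add: ursell.simps[of h A])
qed

lemma ursell_cong:
  assumes "\<And>B. B \<subseteq> A \<Longrightarrow> h B = h' B"
  shows "ursell h A = ursell h' A"
proof (cases "finite A")
  case True
  then show ?thesis using assms
  proof (induction A rule: finite_psubset_induct)
    case (psubset A)
    have "ursell h B = ursell h' B" if "B \<subset> A" for B
      using psubset that by (meson order.trans psubset_imp_subset)
    then show ?case
      using psubset.hyps psubset.prems by (auto simp: ursell.simps[of _ A] intro!: sum.cong)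
  qed
qed (simp add: ursell.simps)

text \<open>
  This is what makes the truncated functions useful: they vanish on configurations that fall apart
  into two independent groups \<open>X\<close> and \<open>Y\<close>. Say \<open>Min (X \<union> Y)\<close> lies in \<open>X\<close>. By induction, a block \<open>B\<close> that
  meets both groups contributes nothing. The blocks \<open>B \<subseteq> X\<close> contribute \<open>h Y\<close> times the expansion of
  \<open>h X\<close>, that is \<open>h X * h Y = h (X \<union> Y)\<close>, which leaves nothing for the block \<open>X \<union> Y\<close> itself.
\<close>

lemma ursell_eq_0_if_factorizes:
  assumes "finite (X \<union> Y)" "X \<noteq> {}" "Y \<noteq> {}" "X \<inter> Y = {}" "h {} = 1"
    and "\<And>B C. B \<subseteq> X \<Longrightarrow> C \<subseteq> Y \<Longrightarrow> h (B \<union> C) = h B * h C"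
  shows "ursell h (X \<union> Y) = 0"
  using assms
proof (induction "card (X \<union> Y)" arbitrary: X Y rule: less_induct)
  case less
  have rooted: "ursell h (X \<union> Y) = 0"
    if XY: "finite (X \<union> Y)" "X \<noteq> {}" "Y \<noteq> {}" "X \<inter> Y = {}" and root: "Min (X \<union> Y) \<in> X"
    and split: "\<And>B C. B \<subseteq> X \<Longrightarrow> C \<subseteq> Y \<Longrightarrow> h (B \<union> C) = h B * h C"
    and IH: "\<And>X' Y'. X' \<subseteq> X \<Longrightarrow> Y' \<subseteq> Y \<Longrightarrow> X' \<union> Y' \<subset> X \<union> Y \<Longrightarrow> X' \<noteq> {} \<Longrightarrow> Y' \<noteq> {}
          \<Longrightarrow> ursell h (X' \<union> Y') = 0" for X Y
  proof -
    define m where "m = Min (X \<union> Y)"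
    have "Min X = m"
      using XY root by (intro Min_eqI) (auto simp: m_def)
    have fin: "finite {B. m \<in> B \<and> B \<subset> X \<union> Y}"
      by (rule finite_subset[OF _ finite_rooted_subsets[OF XY(1), of m]]) auto
    \<comment> \<open>Blocks that meet both groups vanish, so only blocks inside \<open>X\<close> remain.\<close>
    have "(\<Sum>B\<in>{B. m \<in> B \<and> B \<subset> X \<union> Y}. ursell h B * h (X \<union> Y - B))
        = (\<Sum>B\<in>{B. m \<in> B \<and> B \<subseteq> X}. ursell h B * h (X \<union> Y - B))"
    proof (rule sum.mono_neutral_right[OF fin])
      show "{B. m \<in> B \<and> B \<subseteq> X} \<subseteq> {B. m \<in> B \<and> B \<subset> X \<union> Y}"
        using XY by auto
      show "\<forall>B\<in>{B. m \<in> B \<and> B \<subset> X \<union> Y} - {B. m \<in> B \<and> B \<subseteq> X}. ursell h B * h (X \<union> Y - B) = 0"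
      proof
        fix B assume B: "B \<in> {B. m \<in> B \<and> B \<subset> X \<union> Y} - {B. m \<in> B \<and> B \<subseteq> X}"
        then have "B = (B \<inter> X) \<union> (B \<inter> Y)" by auto
        moreover have "ursell h ((B \<inter> X) \<union> (B \<inter> Y)) = 0"
          by (rule IH) (use B root in \<open>auto simp: m_def\<close>)
        ultimately show "ursell h B * h (X \<union> Y - B) = 0" by simp
      qed
    qed
    also have "\<dots> = (\<Sum>B\<in>{B. m \<in> B \<and> B \<subseteq> X}. ursell h B * h (X - B) * h Y)"
    proof (rule sum.cong[OF refl])
      fix B assume B: "B \<in> {B. m \<in> B \<and> B \<subseteq> X}"
      have "X \<union> Y - B = (X - B) \<union> Y" using B XY by auto
      then show "ursell h B * h (X \<union> Y - B) = ursell h B * h (X - B) * h Y"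
        using split[of "X - B" Y] by simp
    qed
    also have "\<dots> = h X * h Y"
      using sum_ursell[of X h] XY less.prems(5) \<open>Min X = m\<close>
      by (simp add: sum_distrib_right[symmetric])
    also have "\<dots> = h (X \<union> Y)" using split by simp
    finally show ?thesis using XY by (simp add: ursell.simps[of h "X \<union> Y"] m_def)
  qed
  have IH: "ursell h (X' \<union> Y') = 0"
    if "X' \<subseteq> X" "Y' \<subseteq> Y" "X' \<union> Y' \<subset> X \<union> Y" "X' \<noteq> {}" "Y' \<noteq> {}" for X' Y'
  proof (rule less.hyps)
    show "card (X' \<union> Y') < card (X \<union> Y)"
      using that less.prems by (intro psubset_card_mono) auto
    show "finite (X' \<union> Y')"
      using that less.prems(1) by (meson finite_subset psubset_imp_subset)
    show "h (B \<union> C) = h B * h C" if "B \<subseteq> X'" "C \<subseteq> Y'" for B C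
      by (rule less.prems(6)) (use that \<open>X' \<subseteq> X\<close> \<open>Y' \<subseteq> Y\<close> in auto)
  qed (use that less.prems(1-5) in auto)
  have "Min (X \<union> Y) \<in> X \<union> Y" using less.prems by (intro Min_in) auto
  then consider "Min (X \<union> Y) \<in> X" | "Min (Y \<union> X) \<in> Y" by (auto simp: Un_commute)
  then show ?case
  proof cases
    case 1
    show ?thesis
      by (rule rooted) (use less.prems(1-5) 1 in \<open>auto intro: less.prems(6) IH\<close>)
  next
    case 2
    have "ursell h (Y \<union> X) = 0"
    proof (rule rooted)
      show "h (B \<union> C) = h B * h C" if "B \<subseteq> Y" "C \<subseteq> X" for B C
        using less.prems(6)[of C B] that by (simp add: Un_commute mult.commute)
      show "ursell h (X' \<union> Y') = 0"
        if "X' \<subseteq> Y" "Y' \<subseteq> X" "X' \<union> Y' \<subset> Y \<union> X" "X' \<noteq> {}" "Y' \<noteq> {}" for X' Y'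
        using IH[of Y' X'] that by (simp add: Un_commute)
    qed (use less.prems(1-5) 2 in auto)
    then show ?thesis by (simp add: Un_commute)
  qed
qed

text \<open>
  That the bound does not depend on \<open>h\<close> makes truncated functions bounded over all configurations,
  hence integrable.
\<close>

lemma abs_ursell_bounded:
  assumes "finite A"
  shows "\<exists>b. \<forall>h. (\<forall>B. \<bar>h B\<bar> \<le> 1) \<longrightarrow> \<bar>ursell h A\<bar> \<le> b"
  using assms
proof (induction A rule: finite_psubset_induct)
  case (psubset A)
  let ?R = "{B. Min A \<in> B \<and> B \<subset> A}"
  from psubset.IH obtain b where
    b: "\<And>B h. B \<subset> A \<Longrightarrow> (\<forall>B. \<bar>h B\<bar> \<le> 1) \<Longrightarrow> \<bar>ursell h B\<bar> \<le> b B"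
    by metis
  have "\<bar>ursell h A\<bar> \<le> 1 + (\<Sum>B\<in>?R. b B)" if h: "\<forall>B. \<bar>h B\<bar> \<le> 1" for h
  proof -
    have "\<bar>\<Sum>B\<in>?R. ursell h B * h (A - B)\<bar> \<le> (\<Sum>B\<in>?R. b B)"
    proof (rule order.trans[OF sum_abs sum_mono])
      fix B assume "B \<in> ?R"
      then have "\<bar>ursell h B\<bar> * \<bar>h (A - B)\<bar> \<le> b B * 1"
        using b[of B h] h by (intro mult_mono) force+
      then show "\<bar>ursell h B * h (A - B)\<bar> \<le> b B" by (simp add: abs_mult)
    qed
    then show ?thesis using h[rule_format, of A] psubset.hyps by (simp add: ursell.simps[of h A])
  qed
  then show ?case by blast
qed

lemma card_rooted_subsets:
  assumes "finite A" "m \<in> A"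
  shows "card {B. m \<in> B \<and> B \<subseteq> A \<and> card B = Suc i} = (card A - 1) choose i"
proof -
  have "bij_betw (insert m) {C. C \<subseteq> A - {m} \<and> card C = i} {B. m \<in> B \<and> B \<subseteq> A \<and> card B = Suc i}"
  proof (rule bij_betwI[where g = "\<lambda>B. B - {m}"])
    show "insert m \<in> {C. C \<subseteq> A - {m} \<and> card C = i} \<rightarrow> {B. m \<in> B \<and> B \<subseteq> A \<and> card B = Suc i}"
    proof
      fix C assume C: "C \<in> {C. C \<subseteq> A - {m} \<and> card C = i}"
      then have "finite C" using assms by (auto intro: finite_subset)
      then show "insert m C \<in> {B. m \<in> B \<and> B \<subseteq> A \<and> card B = Suc i}"
        using C assms by (auto simp: card_insert_if)
    qed
  qed (use assms in auto)
  then have "card {B. m \<in> B \<and> B \<subseteq> A \<and> card B = Suc i} = card {C. C \<subseteq> A - {m} \<and> card C = i}"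
    by (simp add: bij_betw_same_card)
  then show ?thesis using assms n_subsets[of "A - {m}" i] by simp
qed

lemma sum_rooted_subsets:
  fixes f :: "nat \<Rightarrow> real"
  assumes "finite A" "m \<in> A"
  shows "(\<Sum>B\<in>{B. m \<in> B \<and> B \<subseteq> A}. f (card B)) = (\<Sum>i<card A. real ((card A - 1) choose i) * f (Suc i))"
proof -
  let ?R = "{B. m \<in> B \<and> B \<subseteq> A}"
  have "card ` ?R \<subseteq> Suc ` {..<card A}"
  proof
    fix c assume "c \<in> card ` ?R"
    then obtain B where B: "m \<in> B" "B \<subseteq> A" "c = card B" by auto
    then have "0 < c" "c \<le> card A"
      using assms by (auto simp: card_gt_0_iff card_mono intro: finite_subset)
    then show "c \<in> Suc ` {..<card A}" by (intro image_eqI[of _ _ "c - 1"]) auto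
  qed
  then have "(\<Sum>B\<in>?R. f (card B)) = (\<Sum>c\<in>Suc ` {..<card A}. \<Sum>B\<in>{B\<in>?R. card B = c}. f (card B))"
    using finite_rooted_subsets[OF assms(1)] by (intro sum.group[symmetric]) auto
  also have "\<dots> = (\<Sum>i<card A. \<Sum>B\<in>{B. m \<in> B \<and> B \<subseteq> A \<and> card B = Suc i}. f (Suc i))"
    by (simp add: sum.reindex conj_assoc)
  finally show ?thesis by (simp add: card_rooted_subsets[OF assms])
qed

text \<open>
  The polynomials that solve the recursion for non-intersecting placements when the cluster
  integral of \<open>j\<close> copies is \<open>c j * x\<close>, where \<open>x\<close> is the volume. In \<open>cluster_poly c (Suc k)\<close>, \<open>Suc i\<close> is the
  size of the cluster of a distinguished copy.
\<close>

fun cluster_poly :: "(nat \<Rightarrow> real) \<Rightarrow> nat \<Rightarrow> real poly" where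
  "cluster_poly c 0 = 1"
| "cluster_poly c (Suc k) =
     (\<Sum>i\<le>k. smult (real (k choose i) * c (Suc i)) ([:0, 1:] * cluster_poly c (k - i)))"

lemma fps_eqI_linear_ode:
  fixes G H A :: "real fps"
  assumes "fps_deriv G = A * G" "fps_deriv H = A * H" "fps_nth G 0 = fps_nth H 0"
  shows "G = H"
proof (rule fps_ext)
  fix k show "fps_nth G k = fps_nth H k"
  proof (induction k rule: less_induct)
    case (less k)
    show ?case
    proof (cases k)
      case (Suc j)
      have "fps_nth (fps_deriv G) j = fps_nth (fps_deriv H) j"
        unfolding assms fps_mult_nth using less Suc by (auto intro!: sum.cong)
      then show ?thesis using Suc by simp
    qed (use assms in simp)
  qed
qed

text \<open>
  Divided by factorials, the recursion of \<^const>\<open>cluster_poly\<close> says that the generating function \<open>G x\<close> of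
  the values at \<open>x\<close> solves \<open>G' = x A G\<close> with a power series \<open>A\<close> independent of \<open>x\<close>. The power \<open>G 1 ^ m\<close>
  solves the equation for \<open>x = m\<close>, and both series have constant term 1, so \<open>G 1 ^ m = G m\<close>. In closed
  form, \<open>G x\<close> is the exponential of \<open>x\<close> times the antiderivative of \<open>A\<close>.
\<close>

lemma binomial_type_cluster_poly:
  "binomial_type (\<lambda>k. smult (1 / fact k) (cluster_poly c k))"
proof -
  define G where "G x = Abs_fps (\<lambda>k. poly (smult (1 / fact k) (cluster_poly c k)) x)" for x
  define A where "A = Abs_fps (\<lambda>i. c (Suc i) / fact i)"
  have G_nth: "fps_nth (G x) k = poly (cluster_poly c k) x / fact k" for x k
    by (simp add: G_def)
  have ode: "fps_deriv (G x) = fps_const x * (A * G x)" for x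
  proof (rule fps_ext)
    fix k
    have "fps_nth (fps_deriv (G x)) k = poly (cluster_poly c (Suc k)) x / fact k"
      by (simp add: G_nth del: cluster_poly.simps)
    also have "\<dots> = (\<Sum>i\<le>k. (x * (c (Suc i) / fact i)) * (poly (cluster_poly c (k - i)) x / fact (k - i)))"
      by (auto simp: poly_sum sum_divide_distrib binomial_fact field_simps intro!: sum.cong)
    also have "\<dots> = fps_nth (fps_const x * (A * G x)) k"
      unfolding fps_mult_left_const_nth fps_mult_nth[of A]
      by (simp add: A_def G_nth atMost_atLeast0 sum_distrib_left mult.assoc)
    finally show "fps_nth (fps_deriv (G x)) k = fps_nth (fps_const x * (A * G x)) k" .
  qed
  have pow: "G 1 ^ m = G (of_nat m)" for m
  proof (rule fps_eqI_linear_ode[of _ "fps_const (real m) * A"])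
    show "fps_deriv (G 1 ^ m) = fps_const (real m) * A * G 1 ^ m"
    proof (induction m)
      case (Suc m)
      have eq: "fps_const (real (Suc m)) = 1 + fps_const (real m)"
        by (rule fps_ext) simp
      show ?case unfolding eq using Suc ode[of 1] by (simp add: algebra_simps)
    qed simp
    show "fps_deriv (G (of_nat m)) = fps_const (real m) * A * G (of_nat m)"
      by (simp only: ode mult.assoc)
    show "fps_nth (G 1 ^ m) 0 = fps_nth (G (of_nat m)) 0"
      by (simp add: fps_nth_power_0 G_nth)
  qed
  have "poly (cluster_poly c k) 0 = 0" if "k > 0" for k
    using that by (cases k) (auto simp: poly_sum)
  then show ?thesis
    using pow unfolding binomial_type_def G_def by simp
qed

section \<open>Measurable hulls\<close>

definition measurable_hull :: "'a measure \<Rightarrow> 'a set \<Rightarrow> 'a set" where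
  "measurable_hull M E = (SOME H. H \<in> sets M \<and> E \<subseteq> H \<and> outer_measure_of M E = emeasure M H)"

lemma measurable_hull:
  assumes "E \<subseteq> space M"
  shows sets_measurable_hull: "measurable_hull M E \<in> sets M"
    and subset_measurable_hull: "E \<subseteq> measurable_hull M E"
    and emeasure_measurable_hull: "emeasure M (measurable_hull M E) = outer_measure_of M E"
proof -
  have "\<exists>H. H \<in> sets M \<and> E \<subseteq> H \<and> outer_measure_of M E = emeasure M H"
    using outer_measure_of_attain[OF assms] by blast
  from someI_ex[OF this] show "measurable_hull M E \<in> sets M" "E \<subseteq> measurable_hull M E"
    "emeasure M (measurable_hull M E) = outer_measure_of M E"
    unfolding measurable_hull_def by auto
qed

lemma (in finite_measure) AE_subset_if_emeasure_Int_ge: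
  assumes "H \<in> sets M" "G \<in> sets M" "emeasure M H \<le> emeasure M (H \<inter> G)"
  shows "AE x in M. x \<in> H \<longrightarrow> x \<in> G"
proof -
  have "emeasure M (H - (H \<inter> G)) = emeasure M H - emeasure M (H \<inter> G)"
    using assms by (intro emeasure_Diff) auto
  also have "\<dots> = 0"
    using assms by (simp add: diff_eq_0_iff_ennreal less_top[symmetric] emeasure_finite)
  finally have "H - G \<in> null_sets M"
    using assms by (intro null_setsI) (auto simp: Diff_Int)
  from AE_not_in[OF this] show ?thesis by eventually_elim auto
qed

text \<open>
  The hull is the least measurable superset up to null sets. This characterisation, and not the
  choice in the definition, is used whenever two hulls are compared.
\<close>

lemma (in finite_measure) AE_measurable_hull_subset:
  assumes "E \<subseteq> G" "G \<in> sets M"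
  shows "AE x in M. x \<in> measurable_hull M E \<longrightarrow> x \<in> G"
proof -
  have E: "E \<subseteq> space M" using assms sets.sets_into_space by blast
  note H = measurable_hull[OF E]
  have "outer_measure_of M E \<le> emeasure M (measurable_hull M E \<inter> G)"
    unfolding outer_measure_of_def using H assms by (intro INF_lower) auto
  then show ?thesis
    using H assms by (intro AE_subset_if_emeasure_Int_ge) auto
qed

text \<open>
  The hull of \<open>E1 \<times> E2\<close> is the product of the hulls: a measurable subset \<open>Z\<close> of the latter that avoids
  \<open>E1 \<times> E2\<close> is null. Indeed, for \<open>y \<in> E2\<close> the slice of \<open>Z\<close> at \<open>y\<close> avoids \<open>E1\<close> and is null by minimality of
  the first hull. The set of \<open>y\<close> with null slice is measurable and contains \<open>E2\<close>, so by minimality of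
  the second hull almost all slices are null, and Fubini applies.
\<close>

lemma null_sets_in_Times_measurable_hulls:
  assumes "finite_measure M1" "finite_measure M2"
    and E: "E1 \<subseteq> space M1" "E2 \<subseteq> space M2"
    and Z: "Z \<in> sets (M1 \<Otimes>\<^sub>M M2)" "Z \<subseteq> measurable_hull M1 E1 \<times> measurable_hull M2 E2"
      "Z \<inter> E1 \<times> E2 = {}"
  shows "Z \<in> null_sets (M1 \<Otimes>\<^sub>M M2)"
proof -
  interpret M1: finite_measure M1 by fact
  interpret M2: finite_measure M2 by fact
  interpret pair_sigma_finite M1 M2 ..
  define g where "g y = emeasure M1 ((\<lambda>x. (x, y)) -` Z)" for y
  have g[measurable]: "g \<in> borel_measurable M2"
    unfolding g_def by (rule measurable_emeasure_Pair2[OF Z(1)])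
  have slice: "(\<lambda>x. (x, y)) -` Z \<in> sets M1" for y
    using Z(1) by (rule sets_Pair2)
  have "E2 \<subseteq> {y \<in> space M2. g y = 0}"
  proof
    fix y assume y: "y \<in> E2"
    have "AE x in M1. x \<in> measurable_hull M1 E1 \<longrightarrow> x \<in> space M1 - (\<lambda>x. (x, y)) -` Z"
      by (rule M1.AE_measurable_hull_subset) (use E Z y slice in auto)
    then have "AE x in M1. x \<notin> (\<lambda>x. (x, y)) -` Z"
      by eventually_elim (use Z(2) in auto)
    then have "g y = 0"
      unfolding g_def using slice[of y] by (simp add: AE_iff_null_sets null_setsD1)
    then show "y \<in> {y \<in> space M2. g y = 0}" using y E by auto
  qed
  then have "AE y in M2. y \<in> measurable_hull M2 E2 \<longrightarrow> y \<in> {y \<in> space M2. g y = 0}"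
    by (intro M2.AE_measurable_hull_subset) auto
  then have "AE y in M2. g y = 0"
  proof eventually_elim
    case (elim y)
    have "(\<lambda>x. (x, y)) -` Z = {}" if "y \<notin> measurable_hull M2 E2" using Z(2) that by auto
    then show ?case using elim by (cases "y \<in> measurable_hull M2 E2") (auto simp: g_def)
  qed
  then have "emeasure (M1 \<Otimes>\<^sub>M M2) Z = 0"
    unfolding emeasure_pair_measure_alt2[OF Z(1)] g_def[symmetric]
    by (subst nn_integral_0_iff_AE) auto
  then show ?thesis using Z(1) by (simp add: null_setsI)
qed

section \<open>Hard-core configurations\<close>

definition admissible :: "'b measure \<Rightarrow> ('b \<Rightarrow> 'b \<Rightarrow> bool) \<Rightarrow> nat set \<Rightarrow> (nat \<Rightarrow> 'b) set" where
  "admissible M R A = {t \<in> space (PiM A (\<lambda>_. M)). \<forall>i\<in>A. \<forall>j\<in>A. i \<noteq> j \<longrightarrow> R (t i) (t j)}"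

text \<open>
  The argument is restricted to \<open>A\<close> so that one configuration \<open>t\<close> with many labels can be inserted for
  all subsets \<open>A\<close> of its labels at once, as \<^const>\<open>ursell\<close> requires. The name is that of the Boltzmann
  weight in statistical mechanics, which is an indicator function for hard-core interactions.
\<close>

definition boltzmann :: "'b measure \<Rightarrow> ('b \<Rightarrow> 'b \<Rightarrow> bool) \<Rightarrow> (nat \<Rightarrow> 'b) \<Rightarrow> nat set \<Rightarrow> real" where
  "boltzmann M R t A = indicator (measurable_hull (PiM A (\<lambda>_. M)) (admissible M R A)) (restrict t A)"

definition cluster_fn :: "'b measure \<Rightarrow> ('b \<Rightarrow> 'b \<Rightarrow> bool) \<Rightarrow> nat set \<Rightarrow> (nat \<Rightarrow> 'b) \<Rightarrow> real" where
  "cluster_fn M R A t = ursell (boltzmann M R t) A"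

definition cluster_integral :: "'b measure \<Rightarrow> ('b \<Rightarrow> 'b \<Rightarrow> bool) \<Rightarrow> nat set \<Rightarrow> real" where
  "cluster_integral M R A = (\<integral>t. cluster_fn M R A t \<partial>PiM A (\<lambda>_. M))"

definition outer_prob :: "'b measure \<Rightarrow> ('b \<Rightarrow> 'b \<Rightarrow> bool) \<Rightarrow> nat set \<Rightarrow> real" where
  "outer_prob M R A = enn2real (outer_measure_of (PiM A (\<lambda>_. M)) (admissible M R A))"

lemma admissible_subset_space: "admissible M R A \<subseteq> space (PiM A (\<lambda>_. M))"
  by (auto simp: admissible_def)

lemma hull_admissible:
  shows "measurable_hull (PiM A (\<lambda>_. M)) (admissible M R A) \<in> sets (PiM A (\<lambda>_. M))"
    and "admissible M R A \<subseteq> measurable_hull (PiM A (\<lambda>_. M)) (admissible M R A)"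
    and "emeasure (PiM A (\<lambda>_. M)) (measurable_hull (PiM A (\<lambda>_. M)) (admissible M R A))
      = outer_measure_of (PiM A (\<lambda>_. M)) (admissible M R A)"
  by (rule measurable_hull[OF admissible_subset_space])+

lemma admissible_restrict:
  assumes "t \<in> admissible M R A" "B \<subseteq> A"
  shows "restrict t B \<in> admissible M R B"
  using assms by (auto simp: admissible_def space_PiM PiE_iff)

lemma boltzmann_restrict: "B \<subseteq> A \<Longrightarrow> boltzmann M R (restrict t A) B = boltzmann M R t B"
  by (simp add: boltzmann_def restrict_restrict Int_absorb1)

lemma cluster_fn_restrict: "B \<subseteq> A \<Longrightarrow> cluster_fn M R B (restrict t A) = cluster_fn M R B t"
  unfolding cluster_fn_def by (rule ursell_cong) (auto intro: boltzmann_restrict)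

lemma abs_boltzmann_le_1: "\<bar>boltzmann M R t A\<bar> \<le> 1"
  by (simp add: boltzmann_def indicator_def)

lemma boltzmann_empty: "boltzmann M R t {} = 1"
proof -
  have "restrict t {} \<in> admissible M R {}" by (simp add: admissible_def space_PiM restrict_def)
  then show ?thesis
    using hull_admissible(2)[of M R "{}"] by (auto simp: boltzmann_def)
qed

lemma measurable_boltzmann [measurable]:
  assumes "B \<subseteq> A"
  shows "(\<lambda>t. boltzmann M R t B) \<in> borel_measurable (PiM A (\<lambda>_. M))"
proof -
  note hull_admissible(1)[of B M R, measurable]
  have [measurable]: "(\<lambda>t. restrict t B) \<in> measurable (PiM A (\<lambda>_. M)) (PiM B (\<lambda>_. M))"
    using assms by (rule measurable_restrict_subset)
  show ?thesis unfolding boltzmann_def by measurable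
qed

lemma measurable_cluster_fn [measurable]:
  assumes "finite A" "B \<subseteq> A"
  shows "cluster_fn M R B \<in> borel_measurable (PiM A (\<lambda>_. M))"
proof -
  have "finite B" using assms by (auto intro: finite_subset)
  then show ?thesis using assms(2)
  proof (induction B rule: finite_psubset_induct)
    case (psubset B)
    have "cluster_fn M R B = (\<lambda>t. boltzmann M R t B -
        (\<Sum>C\<in>{C. Min B \<in> C \<and> C \<subset> B}. cluster_fn M R C t * boltzmann M R t (B - C)))"
      using psubset.hyps by (simp add: cluster_fn_def fun_eq_iff ursell.simps[of _ B])
    also have "\<dots> \<in> borel_measurable (PiM A (\<lambda>_. M))"
      using psubset.prems
      by (intro borel_measurable_diff borel_measurable_sum borel_measurable_times
          measurable_boltzmann psubset.IH) auto
    finally show ?case .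
  qed
qed

lemma cluster_fn_bounded:
  assumes "finite A"
  obtains b where "\<And>t. \<bar>cluster_fn M R A t\<bar> \<le> b"
  using abs_ursell_bounded[OF assms] abs_boltzmann_le_1 unfolding cluster_fn_def by metis

text \<open>
  Labelled points of \<open>M\<close> with an arbitrary, possibly non-measurable, compatibility relation \<open>R\<close>. The
  measurable relation \<open>near\<close> holds at least where \<open>R\<close> fails, and serves to express that two groups of
  points are too far apart to interact.
\<close>

locale hard_core = prob_space M for M :: "'b measure" +
  fixes R near :: "'b \<Rightarrow> 'b \<Rightarrow> bool"
  assumes measurable_near: "Measurable.pred (M \<Otimes>\<^sub>M M) (\<lambda>(x, y). near x y)"
    and R_if_far: "\<And>x y. \<not> near x y \<Longrightarrow> R x y \<and> R y x"
begin

sublocale product: product_prob_space "\<lambda>_ :: nat. M" by standard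

lemma prob_space_PiM_nat: "prob_space (PiM A (\<lambda>_ :: nat. M))"
  by (rule prob_space_PiM) (rule prob_space_axioms)

lemma finite_measure_PiM: "finite_measure (PiM A (\<lambda>_ :: nat. M))"
  using prob_space_PiM_nat by (rule prob_space.finite_measure)

lemma AE_PiM_restrict:
  fixes A B :: "nat set"
  assumes "finite A" "B \<subseteq> A" "AE t in PiM B (\<lambda>_. M). P t"
  shows "AE t in PiM A (\<lambda>_. M). P (restrict t B)"
proof -
  have "(\<lambda>t. restrict t B) \<in> measurable (PiM A (\<lambda>_. M)) (PiM B (\<lambda>_. M))"
    using assms by (intro measurable_restrict_subset)
  moreover have "AE t in distr (PiM A (\<lambda>_. M)) (PiM B (\<lambda>_. M)) (\<lambda>t. restrict t B). P t"
    unfolding product.distr_restrict[OF assms(2,1), symmetric] by (rule assms(3))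
  ultimately show ?thesis by (rule AE_distrD)
qed

lemma measurable_far [measurable]:
  assumes "X \<subseteq> A" "Y \<subseteq> A" "finite X" "finite Y"
  shows "Measurable.pred (PiM A (\<lambda>_. M)) (\<lambda>t. \<forall>i\<in>X. \<forall>j\<in>Y. \<not> near (t i) (t j))"
proof -
  have "Measurable.pred (PiM A (\<lambda>_. M)) (\<lambda>t. near (t i) (t j))" if "i \<in> X" "j \<in> Y" for i j
  proof -
    have "(\<lambda>t. (t i, t j)) \<in> measurable (PiM A (\<lambda>_. M)) (M \<Otimes>\<^sub>M M)"
      using that assms by (intro measurable_Pair measurable_component_singleton) auto
    from measurable_compose[OF this measurable_near] show ?thesis by simp
  qed
  then show ?thesis
    using assms by (intro pred_intros_finite pred_intros_logic) auto
qed

text \<open>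
  On configurations where \<open>X\<close> and \<open>Y\<close> are far apart, admissibility is a condition on the two parts
  separately. Since being far apart is measurable, the hulls inherit this: one inclusion is
  minimality of the hull for \<open>X \<union> Y\<close>, the other is the product property of hulls.
\<close>

lemma AE_boltzmann_factorizes:
  assumes "finite X" "finite Y" "X \<inter> Y = {}"
  shows "AE t in PiM (X \<union> Y) (\<lambda>_. M). (\<forall>i\<in>X. \<forall>j\<in>Y. \<not> near (t i) (t j)) \<longrightarrow>
    boltzmann M R t (X \<union> Y) = boltzmann M R t X * boltzmann M R t Y"
proof -
  let ?P = "\<lambda>A. PiM A (\<lambda>_ :: nat. M)"
  let ?H = "\<lambda>A. measurable_hull (?P A) (admissible M R A)"
  interpret XY: finite_measure "?P (X \<union> Y)" by (rule finite_measure_PiM)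
  define far where "far t \<longleftrightarrow> (\<forall>i\<in>X. \<forall>j\<in>Y. \<not> near (t i) (t j))" for t
  have [measurable]: "Measurable.pred (?P (X \<union> Y)) far"
    unfolding far_def using assms by (intro measurable_far) auto
  note hull_admissible(1)[measurable]
  have [measurable]: "(\<lambda>t. restrict t X) \<in> measurable (?P (X \<union> Y)) (?P X)"
    "(\<lambda>t. restrict t Y) \<in> measurable (?P (X \<union> Y)) (?P Y)"
    by (auto intro!: measurable_restrict_subset)
  have [measurable]: "merge X Y \<in> measurable (?P X \<Otimes>\<^sub>M ?P Y) (?P (X \<union> Y))"
    by (rule measurable_merge)
  have 1: "AE t in ?P (X \<union> Y). t \<in> ?H (X \<union> Y) \<longrightarrow>
      t \<in> {t \<in> space (?P (X \<union> Y)). far t \<longrightarrow> restrict t X \<in> ?H X \<and> restrict t Y \<in> ?H Y}"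
  proof (rule XY.AE_measurable_hull_subset)
    show "admissible M R (X \<union> Y) \<subseteq>
        {t \<in> space (?P (X \<union> Y)). far t \<longrightarrow> restrict t X \<in> ?H X \<and> restrict t Y \<in> ?H Y}"
      using admissible_restrict[of _ M R "X \<union> Y"] hull_admissible(2)[of M R]
      by (auto simp: subset_iff admissible_def[of _ _ "X \<union> Y"])
  qed measurable
  define Z where "Z = {z \<in> space (?P X \<Otimes>\<^sub>M ?P Y). fst z \<in> ?H X \<and> snd z \<in> ?H Y \<and>
      far (merge X Y z) \<and> merge X Y z \<notin> ?H (X \<union> Y)}"
  have "Z \<in> null_sets (?P X \<Otimes>\<^sub>M ?P Y)"
  proof (rule null_sets_in_Times_measurable_hulls)
    show "Z \<in> sets (?P X \<Otimes>\<^sub>M ?P Y)" unfolding Z_def by measurable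
    show "Z \<subseteq> ?H X \<times> ?H Y" by (auto simp: Z_def)
    have "merge X Y (x, y) \<in> admissible M R (X \<union> Y)"
      if "x \<in> admissible M R X" "y \<in> admissible M R Y" "far (merge X Y (x, y))" for x y
    proof -
      have "R (merge X Y (x, y) i) (merge X Y (x, y) j)"
        if ij: "i \<in> X \<union> Y" "j \<in> X \<union> Y" "i \<noteq> j" for i j
      proof (cases "i \<in> X \<longleftrightarrow> j \<in> X")
        case True
        then show ?thesis
          using ij assms \<open>x \<in> _\<close> \<open>y \<in> _\<close> by (auto simp: merge_def admissible_def)
      next
        case False
        then consider "i \<in> X" "j \<in> Y" | "j \<in> X" "i \<in> Y" using ij by auto
        then show ?thesis
          using \<open>far _\<close> by cases (metis R_if_far far_def)+
      qed
      moreover have "merge X Y (x, y) \<in> space (?P (X \<union> Y))"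
        using that(1,2) measurable_space[OF measurable_merge, of "(x, y)" X "\<lambda>_. M" Y]
        by (simp add: admissible_def space_pair_measure)
      ultimately show ?thesis by (auto simp: admissible_def)
    qed
    then show "Z \<inter> admissible M R X \<times> admissible M R Y = {}"
      using hull_admissible(2)[of M R "X \<union> Y"] by (auto simp: Z_def)
  qed (auto intro!: finite_measure_PiM admissible_subset_space simp del: Un_iff)
  then have "AE z in ?P X \<Otimes>\<^sub>M ?P Y. z \<notin> Z" by (rule AE_not_in)
  then have "AE z in ?P X \<Otimes>\<^sub>M ?P Y. far (merge X Y z) \<and> restrict (merge X Y z) X \<in> ?H X \<and>
      restrict (merge X Y z) Y \<in> ?H Y \<longrightarrow> merge X Y z \<in> ?H (X \<union> Y)"
  proof (rule AE_mp[OF _ AE_I2], intro impI)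
    fix z assume z: "z \<in> space (?P X \<Otimes>\<^sub>M ?P Y)" "z \<notin> Z"
      "far (merge X Y z) \<and> restrict (merge X Y z) X \<in> ?H X \<and> restrict (merge X Y z) Y \<in> ?H Y"
    obtain x y where xy: "z = (x, y)" by (cases z)
    have "restrict (merge X Y (x, y)) X = x" "restrict (merge X Y (x, y)) Y = y"
      using z(1) assms by (auto simp: xy space_pair_measure space_PiM PiE_iff restrict_merge extensional_restrict)
    then show "merge X Y z \<in> ?H (X \<union> Y)" using z by (auto simp: Z_def xy)
  qed
  then have "AE t in distr (?P X \<Otimes>\<^sub>M ?P Y) (?P (X \<union> Y)) (merge X Y).
      far t \<and> restrict t X \<in> ?H X \<and> restrict t Y \<in> ?H Y \<longrightarrow> t \<in> ?H (X \<union> Y)"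
    by (subst AE_distr_iff) auto
  then have 2: "AE t in ?P (X \<union> Y). far t \<and> restrict t X \<in> ?H X \<and> restrict t Y \<in> ?H Y \<longrightarrow> t \<in> ?H (X \<union> Y)"
    unfolding product.distr_merge[OF assms(3,1,2)] .
  from 1 2 AE_space show ?thesis
  proof eventually_elim
    case (elim t)
    from elim(3) have t: "restrict t (X \<union> Y) = t"
      by (simp add: space_PiM PiE_iff extensional_restrict)
    have "t \<in> ?H (X \<union> Y) \<longleftrightarrow> restrict t X \<in> ?H X \<and> restrict t Y \<in> ?H Y" if "far t"
      using elim(1,2) that by blast
    then show ?case unfolding far_def[symmetric] boltzmann_def t
      by (simp add: indicator_def)
  qed
qed

lemma AE_cluster_fn_eq_0:
  assumes "finite A"
  shows "AE t in PiM A (\<lambda>_. M). \<forall>X Y. X \<union> Y = A \<longrightarrow> X \<inter> Y = {} \<longrightarrow> X \<noteq> {} \<longrightarrow> Y \<noteq> {} \<longrightarrow>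
    (\<forall>i\<in>X. \<forall>j\<in>Y. \<not> near (t i) (t j)) \<longrightarrow> cluster_fn M R A t = 0"
proof -
  let ?split = "\<lambda>t X Y. X \<inter> Y = {} \<longrightarrow> (\<forall>i\<in>X. \<forall>j\<in>Y. \<not> near (t i) (t j)) \<longrightarrow>
    boltzmann M R t (X \<union> Y) = boltzmann M R t X * boltzmann M R t Y"
  have split: "AE t in PiM A (\<lambda>_. M). ?split t X Y" if "X \<in> Pow A" "Y \<in> Pow A" for X Y
  proof (cases "X \<inter> Y = {}")
    case True
    have "finite X" "finite Y" using that assms by (auto intro: finite_subset)
    from AE_PiM_restrict[OF assms _ AE_boltzmann_factorizes[OF this True]] that
    have "AE t in PiM A (\<lambda>_. M).
        (\<forall>i\<in>X. \<forall>j\<in>Y. \<not> near (restrict t (X \<union> Y) i) (restrict t (X \<union> Y) j)) \<longrightarrow>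
        boltzmann M R (restrict t (X \<union> Y)) (X \<union> Y)
          = boltzmann M R (restrict t (X \<union> Y)) X * boltzmann M R (restrict t (X \<union> Y)) Y"
      by auto
    then show ?thesis
      by eventually_elim (simp add: boltzmann_restrict)
  qed auto
  have "finite (Pow A)" using assms by simp
  then have "AE t in PiM A (\<lambda>_. M). \<forall>X\<in>Pow A. \<forall>Y\<in>Pow A. ?split t X Y"
    by (intro AE_finite_allI split)
  then show ?thesis
  proof eventually_elim
    case (elim t)
    show ?case
    proof (intro allI impI)
      fix X Y assume XY: "X \<union> Y = A" "X \<inter> Y = {}" "X \<noteq> {}" "Y \<noteq> {}"
        and far: "\<forall>i\<in>X. \<forall>j\<in>Y. \<not> near (t i) (t j)"
      have "ursell (boltzmann M R t) (X \<union> Y) = 0"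
      proof (rule ursell_eq_0_if_factorizes)
        fix B C assume BC: "B \<subseteq> X" "C \<subseteq> Y"
        then have "B \<in> Pow A" "C \<in> Pow A" "B \<inter> C = {}" using XY by auto
        moreover have "\<forall>i\<in>B. \<forall>j\<in>C. \<not> near (t i) (t j)" using BC far by blast
        ultimately show "boltzmann M R t (B \<union> C) = boltzmann M R t B * boltzmann M R t C"
          using elim[THEN bspec, THEN bspec, THEN mp, THEN mp] by blast
      qed (use XY assms in \<open>auto simp: boltzmann_empty\<close>)
      then show "cluster_fn M R A t = 0" using XY by (simp add: cluster_fn_def)
    qed
  qed
qed

lemma integrable_bounded_PiM:
  assumes "f \<in> borel_measurable (PiM A (\<lambda>_ :: nat. M))" "\<And>t. \<bar>f t\<bar> \<le> (b :: real)"
  shows "integrable (PiM A (\<lambda>_. M)) f"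
proof -
  interpret finite_measure "PiM A (\<lambda>_ :: nat. M)" by (rule finite_measure_PiM)
  show ?thesis using assms by (intro integrable_const_bound[of _ b]) auto
qed

lemma integrable_cluster_fn_boltzmann:
  assumes "finite A" "B \<subseteq> A" "C \<subseteq> A"
  shows "integrable (PiM A (\<lambda>_. M)) (\<lambda>t. cluster_fn M R B t * boltzmann M R t C)"
proof -
  have "finite B" using assms by (auto intro: finite_subset)
  then obtain b where b: "\<And>t. \<bar>cluster_fn M R B t\<bar> \<le> b" by (rule cluster_fn_bounded[of B M R]) blast
  have "\<bar>cluster_fn M R B t * boltzmann M R t C\<bar> \<le> b * 1" for t
    unfolding abs_mult using b[of t] abs_boltzmann_le_1[of M R t C] by (intro mult_mono) auto
  then show ?thesis
    using assms by (intro integrable_bounded_PiM[of _ _ "b * 1"] borel_measurable_times) auto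
qed

lemma integral_cluster_fn_boltzmann:
  assumes "finite A" "B \<subseteq> A"
  shows "(\<integral>t. cluster_fn M R B t * boltzmann M R t (A - B) \<partial>PiM A (\<lambda>_. M))
    = cluster_integral M R B * (\<integral>t. boltzmann M R t (A - B) \<partial>PiM (A - B) (\<lambda>_. M))"
proof -
  let ?f = "\<lambda>t. cluster_fn M R B t * boltzmann M R t (A - B)"
  have A: "B \<union> (A - B) = A" using assms by auto
  have fin: "finite B" "finite (A - B)" using assms by (auto intro: finite_subset)
  have "(\<integral>t. ?f t \<partial>PiM A (\<lambda>_. M))
      = (\<integral>x. (\<integral>y. ?f (merge B (A - B) (x, y)) \<partial>PiM (A - B) (\<lambda>_. M)) \<partial>PiM B (\<lambda>_. M))"
    using product.product_integral_fold[of B "A - B" ?f, unfolded A] fin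
      integrable_cluster_fn_boltzmann[OF assms(1,2), of "A - B"] by simp
  also have "\<dots> = (\<integral>x. (\<integral>y. cluster_fn M R B x * boltzmann M R y (A - B)
      \<partial>PiM (A - B) (\<lambda>_. M)) \<partial>PiM B (\<lambda>_. M))"
  proof -
    have "cluster_fn M R B (merge B (A - B) (x, y)) = cluster_fn M R B x" for x y
      using cluster_fn_restrict[of B B M R "merge B (A - B) (x, y)"] cluster_fn_restrict[of B B M R x]
      by (simp add: restrict_merge)
    moreover have "boltzmann M R (merge B (A - B) (x, y)) (A - B) = boltzmann M R y (A - B)" for x y
      using boltzmann_restrict[of "A - B" "A - B" M R "merge B (A - B) (x, y)"]
        boltzmann_restrict[of "A - B" "A - B" M R y]
      by (simp add: restrict_merge)
    ultimately show ?thesis by simp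
  qed
  finally show ?thesis by (simp add: cluster_integral_def)
qed

lemma integral_boltzmann:
  "(\<integral>t. boltzmann M R t A \<partial>PiM A (\<lambda>_. M)) = outer_prob M R A"
proof -
  let ?H = "measurable_hull (PiM A (\<lambda>_. M)) (admissible M R A)"
  have "(\<integral>t. boltzmann M R t A \<partial>PiM A (\<lambda>_. M)) = (\<integral>t. indicator ?H t \<partial>PiM A (\<lambda>_. M))"
    by (rule Bochner_Integration.integral_cong)
       (auto simp: boltzmann_def space_PiM PiE_iff extensional_restrict)
  also have "\<dots> = measure (PiM A (\<lambda>_. M)) ?H"
    using hull_admissible(1)[of A M R] by (simp add: sets.sets_into_space Int_absorb2)
  finally show ?thesis
    by (simp add: outer_prob_def measure_def hull_admissible(3))
qed

text \<open>
  Relabelling the points by a bijection preserves both the product measure and admissibility, so the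
  preimage of a hull is a measurable superset. Applied to a bijection and to its inverse, this shows
  that outer probabilities depend on the number of labels only.
\<close>

lemma outer_measure_admissible_le:
  assumes "bij_betw f I K"
  shows "outer_measure_of (PiM K (\<lambda>_. M)) (admissible M R K)
    \<le> outer_measure_of (PiM I (\<lambda>_. M)) (admissible M R I)"
proof -
  let ?T = "\<lambda>\<omega>. \<lambda>n\<in>I. \<omega> (f n)"
  let ?H = "measurable_hull (PiM I (\<lambda>_. M)) (admissible M R I)"
  have inj: "inj_on f I" and im: "f ` I = K" using assms by (auto simp: bij_betw_def)
  have T[measurable]: "?T \<in> measurable (PiM K (\<lambda>_. M)) (PiM I (\<lambda>_. M))"
    using im by (intro measurable_restrict measurable_component_singleton) auto
  have D: "distr (PiM K (\<lambda>_. M)) (PiM I (\<lambda>_. M)) ?T = PiM I (\<lambda>_. M)"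
    using inj im prob_space_axioms by (intro distr_PiM_reindex) auto
  have "admissible M R K \<subseteq> ?T -` ?H \<inter> space (PiM K (\<lambda>_. M))"
  proof
    fix t assume t: "t \<in> admissible M R K"
    then have "?T t \<in> space (PiM I (\<lambda>_. M))"
      using measurable_space[OF T] by (auto simp: admissible_def)
    then have "?T t \<in> admissible M R I"
      using t by (auto simp: admissible_def im[symmetric] inj_on_eq_iff[OF inj])
    then show "t \<in> ?T -` ?H \<inter> space (PiM K (\<lambda>_. M))"
      using hull_admissible(2)[of M R I] t by (auto simp: admissible_def)
  qed
  then have "outer_measure_of (PiM K (\<lambda>_. M)) (admissible M R K)
      \<le> emeasure (PiM K (\<lambda>_. M)) (?T -` ?H \<inter> space (PiM K (\<lambda>_. M)))"
    unfolding outer_measure_of_def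
    using measurable_sets[OF T hull_admissible(1)[of I M R]] by (intro INF_lower) auto
  also have "\<dots> = emeasure (distr (PiM K (\<lambda>_. M)) (PiM I (\<lambda>_. M)) ?T) ?H"
    by (rule emeasure_distr[symmetric]) (use T hull_admissible(1)[of I M R] in auto)
  also have "\<dots> = outer_measure_of (PiM I (\<lambda>_. M)) (admissible M R I)"
    unfolding D by (rule hull_admissible(3))
  finally show ?thesis .
qed

lemma outer_prob_card:
  assumes "finite A"
  shows "outer_prob M R A = outer_prob M R {..<card A}"
proof -
  obtain f where "bij_betw f {..<card A} A"
    using ex_bij_betw_nat_finite[OF assms] by (auto simp: atLeast0LessThan)
  from outer_measure_admissible_le[OF this] outer_measure_admissible_le[OF bij_betw_inv_into[OF this]]
  show ?thesis unfolding outer_prob_def by (metis order.antisym)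
qed

lemma outer_prob_empty: "outer_prob M R {} = 1"
  using integral_boltzmann[of "{}"] prob_space.prob_space[OF prob_space_PiM_nat[of "{}"]]
  by (simp add: boltzmann_empty)

text \<open>
  The expansion that defines \<^const>\<open>ursell\<close>, integrated term by term: the points in \<open>B\<close> and in \<open>A - B\<close> are
  independent.
\<close>

lemma outer_prob_eq_sum_cluster_integral:
  assumes "finite A" "A \<noteq> {}"
  shows "outer_prob M R A =
    (\<Sum>B\<in>{B. Min A \<in> B \<and> B \<subseteq> A}. cluster_integral M R B * outer_prob M R {..<card A - card B})"
proof -
  have "outer_prob M R A = (\<integral>t. (\<Sum>B\<in>{B. Min A \<in> B \<and> B \<subseteq> A}.
      cluster_fn M R B t * boltzmann M R t (A - B)) \<partial>PiM A (\<lambda>_. M))"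
    unfolding integral_boltzmann[symmetric] cluster_fn_def
    by (intro Bochner_Integration.integral_cong refl sum_ursell assms boltzmann_empty)
  also have "\<dots> = (\<Sum>B\<in>{B. Min A \<in> B \<and> B \<subseteq> A}.
      \<integral>t. cluster_fn M R B t * boltzmann M R t (A - B) \<partial>PiM A (\<lambda>_. M))"
    using assms by (intro Bochner_Integration.integral_sum integrable_cluster_fn_boltzmann) auto
  also have "\<dots> = (\<Sum>B\<in>{B. Min A \<in> B \<and> B \<subseteq> A}.
      cluster_integral M R B * outer_prob M R {..<card A - card B})"
  proof (rule sum.cong[OF refl])
    fix B assume B: "B \<in> {B. Min A \<in> B \<and> B \<subseteq> A}"
    have "card (A - B) = card A - card B"
      using B assms by (intro card_Diff_subset) (auto intro: finite_subset)
    then show "(\<integral>t. cluster_fn M R B t * boltzmann M R t (A - B) \<partial>PiM A (\<lambda>_. M))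
        = cluster_integral M R B * outer_prob M R {..<card A - card B}"
      using B assms outer_prob_card[of "A - B"]
      by (simp add: integral_cluster_fn_boltzmann integral_boltzmann)
  qed
  finally show ?thesis .
qed

text \<open>
  The integrated expansion expresses \<open>cluster_integral M R A\<close> through outer probabilities and cluster
  integrals of proper subsets. Hence the symmetry of outer probabilities carries over by induction,
  although the root \<open>Min A\<close> breaks the symmetry of the integrand.
\<close>

lemma cluster_integral_card:
  assumes "finite A" "A \<noteq> {}"
  shows "cluster_integral M R A = cluster_integral M R {..<card A}"
  using assms
proof (induction "card A" arbitrary: A rule: less_induct)
  case less
  define f where "f c = cluster_integral M R {..<c} * outer_prob M R {..<card A - c}" for c
  have key: "cluster_integral M R A' = outer_prob M R {..<card A}
      - ((\<Sum>i<card A. real ((card A - 1) choose i) * f (Suc i)) - f (card A))"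
    if A': "finite A'" "A' \<noteq> {}" "card A' = card A" for A'
  proof -
    let ?S = "{B. Min A' \<in> B \<and> B \<subset> A'}"
    have R: "{B. Min A' \<in> B \<and> B \<subseteq> A'} = insert A' ?S"
      using A' Min_in by auto
    have fin: "finite ?S"
      by (rule finite_subset[OF _ finite_rooted_subsets[OF A'(1), of "Min A'"]]) auto
    have "cluster_integral M R B = cluster_integral M R {..<card B}" if "B \<in> ?S" for B
      using that A' psubset_card_mono[of A' B]
      by (intro less.hyps) (auto intro: finite_subset)
    then have "outer_prob M R A' = cluster_integral M R A' + (\<Sum>B\<in>?S. f (card B))"
      unfolding outer_prob_eq_sum_cluster_integral[OF A'(1,2)] R
      using fin A' by (simp add: f_def outer_prob_empty)
    moreover have "(\<Sum>B\<in>?S. f (card B)) = (\<Sum>B\<in>{B. Min A' \<in> B \<and> B \<subseteq> A'}. f (card B)) - f (card A')"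
      unfolding R using fin by simp
    ultimately show ?thesis
      using sum_rooted_subsets[of A' "Min A'" f] outer_prob_card[of A'] A' by simp
  qed
  have "card A \<noteq> 0" using less.prems by auto
  then have "{..<card A} \<noteq> {}" by auto
  with key[of A] key[of "{..<card A}"] less.prems show ?case by simp
qed

lemma outer_prob_Suc:
  "outer_prob M R {..<Suc k} = (\<Sum>i\<le>k. real (k choose i) * cluster_integral M R {..<Suc i} * outer_prob M R {..<k - i})"
proof -
  let ?R = "{B. Min {..<Suc k} \<in> B \<and> B \<subseteq> {..<Suc k}}"
  define f where "f c = cluster_integral M R {..<c} * outer_prob M R {..<Suc k - c}" for c
  have "cluster_integral M R B = cluster_integral M R {..<card B}" if "B \<in> ?R" for B
    using that by (intro cluster_integral_card) (auto intro: finite_subset)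
  then have "outer_prob M R {..<Suc k} = (\<Sum>B\<in>?R. f (card B))"
    by (subst outer_prob_eq_sum_cluster_integral) (auto simp: f_def intro!: sum.cong)
  also have "\<dots> = (\<Sum>i<Suc k. real (k choose i) * f (Suc i))"
    using sum_rooted_subsets[of "{..<Suc k}" "Min {..<Suc k}" f] Min_in[of "{..<Suc k}"]
    by auto
  finally show ?thesis by (simp add: f_def mult.assoc lessThan_Suc_atMost)
qed

end

section \<open>Translation invariance of cluster integrals\<close>

lemma (in finite_measure) AE_subset_converse_if_emeasure_eq:
  assumes "H \<in> sets M" "G \<in> sets M" "emeasure M G = emeasure M H"
    and "AE x in M. x \<in> H \<longrightarrow> x \<in> G"
  shows "AE x in M. x \<in> G \<longrightarrow> x \<in> H"
proof (rule AE_subset_if_emeasure_Int_ge[OF assms(2,1)])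
  have "emeasure M (G \<inter> H) = emeasure M H"
    using assms by (intro emeasure_eq_AE) (auto elim!: eventually_mono)
  then show "emeasure M G \<le> emeasure M (G \<inter> H)" using assms by simp
qed

lemma boltzmann_compose:
  assumes "B \<subseteq> A"
  shows "boltzmann M R (compose A T t) B = boltzmann M R (compose B T (restrict t B)) B"
proof -
  have "restrict (compose A T t) B = restrict (compose B T (restrict t B)) B"
    using assms by (auto simp: compose_def fun_eq_iff)
  then show ?thesis by (simp add: boltzmann_def)
qed

context hard_core
begin

text \<open>
  The preimage of the hull under \<open>T\<close> contains the invariant set of admissible configurations, so it
  contains the hull almost everywhere. It has the same finite measure as the hull, so the two sets agree
  almost everywhere.
\<close>

lemma AE_boltzmann_invariant:
  assumes "finite A" and T[measurable]: "T \<in> measurable M M" and distr: "distr M M T = M"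
    and R: "\<And>x y. R (T x) (T y) = R x y"
  shows "AE t in PiM A (\<lambda>_. M). boltzmann M R (compose A T t) A = boltzmann M R t A"
proof -
  let ?P = "PiM A (\<lambda>_ :: nat. M)"
  let ?H = "measurable_hull ?P (admissible M R A)"
  interpret P: finite_measure ?P by (rule finite_measure_PiM)
  note H[measurable] = hull_admissible(1)[of A M R]
  have C[measurable]: "compose A T \<in> measurable ?P ?P"
  proof -
    have "compose A T = (\<lambda>t. \<lambda>i\<in>A. T (t i))" by (auto simp: compose_def fun_eq_iff)
    then show ?thesis by simp
  qed
  have D: "distr ?P ?P (compose A T) = ?P"
    using distr_PiM_finite_prob_space'[of A "\<lambda>_. M" "\<lambda>_. M" T] assms(1) prob_space_axioms distr by simp
  define G where "G = compose A T -` ?H \<inter> space ?P"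
  have G: "G \<in> sets ?P" unfolding G_def by measurable
  have "admissible M R A \<subseteq> G"
  proof
    fix t assume t: "t \<in> admissible M R A"
    then have "compose A T t \<in> admissible M R A"
      using measurable_space[OF C, of t] by (auto simp: admissible_def R compose_eq)
    then show "t \<in> G"
      using t hull_admissible(2)[of M R A] by (auto simp: G_def admissible_def)
  qed
  then have 1: "AE t in ?P. t \<in> ?H \<longrightarrow> t \<in> G"
    using G by (rule P.AE_measurable_hull_subset)
  have "emeasure ?P G = emeasure (distr ?P ?P (compose A T)) ?H"
    unfolding G_def by (rule emeasure_distr[symmetric]) auto
  then have "emeasure ?P G = emeasure ?P ?H" by (simp only: D)
  from P.AE_subset_converse_if_emeasure_eq[OF H G this 1] 1 AE_space
  show ?thesis
  proof eventually_elim
    case (elim t)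
    from elim(3) have "restrict t A = t" "restrict (compose A T t) A = compose A T t"
      by (auto simp: space_PiM PiE_iff extensional_restrict compose_def)
    moreover have "compose A T t \<in> ?H \<longleftrightarrow> t \<in> ?H" using elim by (auto simp: G_def)
    ultimately show ?case by (simp add: boltzmann_def indicator_def)
  qed
qed

lemma AE_cluster_fn_invariant:
  assumes "finite A" "T \<in> measurable M M" "distr M M T = M" "\<And>x y. R (T x) (T y) = R x y"
  shows "AE t in PiM A (\<lambda>_. M). cluster_fn M R A (compose A T t) = cluster_fn M R A t"
proof -
  have "AE t in PiM A (\<lambda>_. M). \<forall>B\<in>Pow A. boltzmann M R (compose A T t) B = boltzmann M R t B"
  proof (rule AE_finite_allI)
    fix B assume "B \<in> Pow A"
    then have B: "B \<subseteq> A" "finite B" using assms by (auto intro: finite_subset)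
    from AE_PiM_restrict[OF assms(1) B(1) AE_boltzmann_invariant[OF B(2) assms(2-4)]]
    show "AE t in PiM A (\<lambda>_. M). boltzmann M R (compose A T t) B = boltzmann M R t B"
      unfolding boltzmann_compose[OF B(1)] by eventually_elim (simp add: boltzmann_restrict)
  qed (use assms in simp)
  then show ?thesis
    unfolding cluster_fn_def by eventually_elim (auto intro: ursell_cong)
qed

text \<open>
  Translating all points by \<open>s\<close> preserves the product measure and the cluster function, so the integral
  on the right is unchanged if \<open>t a\<close> is replaced by \<open>T s (t a)\<close> in the indicator. Average over \<open>s\<close>: as \<open>T s (t a)\<close> is then distributed according to \<open>M\<close>, the indicator turns
  into the factor \<open>measure M W\<close>.
\<close>

lemma cluster_integral_pinned:
  fixes T :: "'b \<Rightarrow> 'b \<Rightarrow> 'b"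
  assumes A: "finite A" "a \<in> A" and W[measurable]: "W \<in> sets M"
    and T[measurable]: "(\<lambda>(s, x). T s x) \<in> measurable (M \<Otimes>\<^sub>M M) M"
    and distr: "\<And>s. s \<in> space M \<Longrightarrow> distr M M (T s) = M" "\<And>x. x \<in> space M \<Longrightarrow> distr M M (\<lambda>s. T s x) = M"
    and R: "\<And>s x y. R (T s x) (T s y) = R x y"
  shows "cluster_integral M R A * measure M W
    = (\<integral>t. indicator W (t a) * cluster_fn M R A t \<partial>PiM A (\<lambda>_. M))"
proof -
  let ?P = "PiM A (\<lambda>_ :: nat. M)"
  interpret P: prob_space ?P by (rule prob_space_PiM_nat)
  interpret PM: pair_prob_space ?P M ..
  obtain b where b: "\<And>t. \<bar>cluster_fn M R A t\<bar> \<le> b"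
    using cluster_fn_bounded[of A M R] A by blast
  have b0: "0 \<le> b" using b[of undefined] by linarith
  have cm[measurable]: "cluster_fn M R A \<in> borel_measurable ?P"
    using A by (intro measurable_cluster_fn) auto
  have ta[measurable]: "(\<lambda>t. t a) \<in> measurable ?P M" using A by measurable
  have pinned[measurable]: "(\<lambda>t. indicator W (t a) * cluster_fn M R A t) \<in> borel_measurable ?P"
    by measurable
  have bound: "\<bar>indicator W x * cluster_fn M R A t\<bar> \<le> b" for x t
    using b[of t] b0 by (simp add: indicator_def)
  have shift: "(\<integral>t. indicator W (T s (t a)) * cluster_fn M R A t \<partial>?P)
      = (\<integral>t. indicator W (t a) * cluster_fn M R A t \<partial>?P)" if s: "s \<in> space M" for s
  proof -
    have Ts[measurable]: "T s \<in> measurable M M"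
      using measurable_Pair2[OF T s] by simp
    have C[measurable]: "compose A (T s) \<in> measurable ?P ?P"
    proof -
      have "compose A (T s) = (\<lambda>t. \<lambda>i\<in>A. T s (t i))" by (auto simp: compose_def fun_eq_iff)
      then show ?thesis by simp
    qed
    have D: "distr ?P ?P (compose A (T s)) = ?P"
      using distr_PiM_finite_prob_space'[of A "\<lambda>_. M" "\<lambda>_. M" "T s"] A prob_space_axioms distr(1)[OF s]
      by simp
    have "(\<integral>t. indicator W (t a) * cluster_fn M R A t \<partial>?P)
        = (\<integral>t. indicator W (t a) * cluster_fn M R A t \<partial>distr ?P ?P (compose A (T s)))"
      by (simp only: D)
    also have "\<dots> = (\<integral>t. indicator W (compose A (T s) t a) * cluster_fn M R A (compose A (T s) t) \<partial>?P)"
      by (rule integral_distr) measurable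
    also have "\<dots> = (\<integral>t. indicator W (T s (t a)) * cluster_fn M R A t \<partial>?P)"
    proof (rule integral_cong_AE)
      show "AE t in ?P. indicator W (compose A (T s) t a) * cluster_fn M R A (compose A (T s) t)
          = indicator W (T s (t a)) * cluster_fn M R A t"
        using AE_cluster_fn_invariant[OF A(1) Ts distr(1)[OF s] R]
        by eventually_elim (use A in \<open>simp add: compose_eq\<close>)
      show "(\<lambda>t. indicator W (compose A (T s) t a) * cluster_fn M R A (compose A (T s) t)) \<in> borel_measurable ?P"
        using measurable_compose[OF C pinned] by simp
    qed measurable
    finally show ?thesis by simp
  qed
  have int: "integrable (?P \<Otimes>\<^sub>M M) (\<lambda>(t, s). indicator W (T s (t a)) * cluster_fn M R A t)"
  proof (rule PM.integrable_const_bound[of _ b])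
    show "(\<lambda>(t, s). indicator W (T s (t a)) * cluster_fn M R A t) \<in> borel_measurable (?P \<Otimes>\<^sub>M M)"
    proof -
      have "(\<lambda>(t, s). T s (t a)) \<in> measurable (?P \<Otimes>\<^sub>M M) M"
        using measurable_compose[OF measurable_Pair[OF measurable_snd measurable_compose[OF measurable_fst ta]] T]
        by (simp add: case_prod_beta)
      then show ?thesis by measurable
    qed
    show "AE x in ?P \<Otimes>\<^sub>M M. norm (case x of (t, s) \<Rightarrow> indicator W (T s (t a)) * cluster_fn M R A t) \<le> b"
      using bound by (auto simp: case_prod_beta)
  qed
  have "(\<integral>t. indicator W (t a) * cluster_fn M R A t \<partial>?P)
      = (\<integral>s. (\<integral>t. indicator W (T s (t a)) * cluster_fn M R A t \<partial>?P) \<partial>M)"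
    using shift by (subst Bochner_Integration.integral_cong[OF refl, of M _ "\<lambda>_. \<integral>t. indicator W (t a) * cluster_fn M R A t \<partial>?P"])
      (auto simp: prob_space)
  also have "\<dots> = (\<integral>t. (\<integral>s. indicator W (T s (t a)) * cluster_fn M R A t \<partial>M) \<partial>?P)"
    using PM.Fubini_integral[OF int] .
  also have "\<dots> = (\<integral>t. measure M W * cluster_fn M R A t \<partial>?P)"
  proof (rule Bochner_Integration.integral_cong[OF refl])
    fix t assume "t \<in> space ?P"
    then have x: "t a \<in> space M" using A by (auto simp: space_PiM)
    have [measurable]: "(\<lambda>s. T s (t a)) \<in> measurable M M"
      using measurable_Pair1[OF T x] by simp
    have "(\<integral>s. indicator W (T s (t a)) \<partial>M) = (\<integral>s. indicator W s \<partial>distr M M (\<lambda>s. T s (t a)) :: real)"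
      by (rule integral_distr[symmetric]) auto
    also have "\<dots> = measure M W"
      unfolding distr(2)[OF x] using sets.sets_into_space[OF W] by (simp add: Int_absorb2)
    finally show "(\<integral>s. indicator W (T s (t a)) * cluster_fn M R A t \<partial>M) = measure M W * cluster_fn M R A t"
      by simp
  qed
  finally show ?thesis by (simp add: cluster_integral_def mult.commute)
qed

end

section \<open>Restriction to a region\<close>

lemma PiM_uniform_measure:
  assumes "finite A" "prob_space M" "C \<in> sets M" "emeasure M C \<noteq> 0"
  shows "PiM A (\<lambda>_ :: 'i. uniform_measure M C) = uniform_measure (PiM A (\<lambda>_. M)) (PiE A (\<lambda>_. C))"
proof -
  interpret M: prob_space M by fact
  interpret U: prob_space "uniform_measure M C"
    using assms by (intro prob_space_uniform_measure) auto
  interpret P: product_prob_space "\<lambda>_ :: 'i. M" ..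
  interpret U: product_prob_space "\<lambda>_ :: 'i. uniform_measure M C" ..
  have C: "measure M C > 0"
    using assms by (simp add: M.emeasure_eq_measure zero_less_measure_iff)
  show ?thesis
  proof (rule U.PiM_eqI[symmetric, OF assms(1)])
    show "sets (uniform_measure (PiM A (\<lambda>_. M)) (PiE A (\<lambda>_. C))) = sets (PiM A (\<lambda>_. uniform_measure M C))"
      by (simp cong: sets_PiM_cong)
    fix X assume "\<And>i. i \<in> A \<Longrightarrow> X i \<in> sets (uniform_measure M C)"
    then have X: "X i \<in> sets M" if "i \<in> A" for i using that by simp
    have "PiE A (\<lambda>_. C) \<inter> PiE A X = PiE A (\<lambda>i. C \<inter> X i)" by (auto simp: PiE_iff)
    then have "emeasure (uniform_measure (PiM A (\<lambda>_. M)) (PiE A (\<lambda>_. C))) (PiE A X)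
        = emeasure (PiM A (\<lambda>_. M)) (PiE A (\<lambda>i. C \<inter> X i)) / emeasure (PiM A (\<lambda>_. M)) (PiE A (\<lambda>_. C))"
      using X assms by (simp add: sets_PiM_I_finite)
    also have "\<dots> = (\<Prod>i\<in>A. ennreal (measure M (C \<inter> X i))) / (\<Prod>i\<in>A. ennreal (measure M C))"
      using X assms by (simp add: P.emeasure_PiM M.emeasure_eq_measure)
    also have "\<dots> = ennreal (\<Prod>i\<in>A. measure M (C \<inter> X i) / measure M C)"
      using C by (simp add: prod_ennreal prod_nonneg prod_pos divide_ennreal prod_dividef del: prod_constant)
    also have "\<dots> = (\<Prod>i\<in>A. emeasure (uniform_measure M C) (X i))"
      using X assms C
      by (subst prod_ennreal[symmetric]) (auto simp: M.emeasure_eq_measure divide_ennreal intro!: prod.cong)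
    finally show "emeasure (uniform_measure (PiM A (\<lambda>_. M)) (PiE A (\<lambda>_. C))) (PiE A X)
        = (\<Prod>i\<in>A. emeasure (uniform_measure M C) (X i))" .
  qed
qed

lemma integral_uniform_measure:
  fixes f :: "'a \<Rightarrow> real"
  assumes "prob_space M" "C \<in> sets M" "emeasure M C \<noteq> 0" "f \<in> borel_measurable M"
  shows "(\<integral>x. indicator C x * f x \<partial>M) = measure M C * (\<integral>x. f x \<partial>uniform_measure M C)"
proof -
  interpret prob_space M by fact
  have C: "measure M C > 0"
    using assms by (simp add: emeasure_eq_measure zero_less_measure_iff)
  have "uniform_measure M C = density M (\<lambda>x. ennreal (indicator C x / measure M C))"
    unfolding uniform_measure_def using assms C
    by (intro density_cong) (auto simp: emeasure_eq_measure divide_ennreal[symmetric] split: split_indicator)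
  then have "(\<integral>x. f x \<partial>uniform_measure M C) = (\<integral>x. (indicator C x / measure M C) * f x \<partial>M)"
    using assms C by (simp add: integral_density)
  also have "\<dots> = (\<integral>x. indicator C x * f x \<partial>M) / measure M C" by simp
  finally show ?thesis using C by simp
qed


text \<open>
  Only the relation between points of \<open>Q\<close> influences the hull on configurations inside \<open>Q\<close>. The two
  hulls belong to different measures. They can be compared because the second measure is
  proportional to the first one on \<open>C\<close>, which contains \<open>Q\<close>.
\<close>

lemma AE_boltzmann_uniform_measure:
  assumes A: "finite A" and M: "prob_space M" and C: "C \<in> sets M" "emeasure M C \<noteq> 0"
    and Q: "Q \<in> sets M" "Q \<subseteq> C"
    and R: "\<forall>x\<in>Q. \<forall>y\<in>Q. R x y \<longleftrightarrow> R' x y"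
  shows "AE t in PiM A (\<lambda>_. uniform_measure M C). (\<forall>i\<in>A. t i \<in> Q) \<longrightarrow>
    boltzmann M R t A = boltzmann (uniform_measure M C) R' t A"
proof -
  define M' where "M' = uniform_measure M C"
  let ?P = "PiM A (\<lambda>_. M)" and ?P' = "PiM A (\<lambda>_. M')"
  let ?H = "measurable_hull ?P (admissible M R A)" and ?H' = "measurable_hull ?P' (admissible M' R' A)"
  have M': "prob_space M'"
    unfolding M'_def using M C
    by (intro prob_space_uniform_measure) (auto simp: finite_measure.emeasure_eq_measure[OF prob_space.finite_measure])
  have P': "?P' = uniform_measure ?P (PiE A (\<lambda>_. C))"
    unfolding M'_def using A M C by (rule PiM_uniform_measure)
  have sets: "sets ?P' = sets ?P" and space: "space ?P' = space ?P"
    unfolding P' by simp_all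
  have QA: "PiE A (\<lambda>_. Q) \<in> sets ?P" using A Q by (intro sets_PiM_I_finite) auto
  have CA: "PiE A (\<lambda>_. C) \<in> sets ?P" using A C by (intro sets_PiM_I_finite) auto
  have adm: "admissible M R A \<inter> PiE A (\<lambda>_. Q) = admissible M' R' A \<inter> PiE A (\<lambda>_. Q)"
    using R by (auto simp: admissible_def space PiE_iff)
  note H = hull_admissible(1)[of A M R] hull_admissible(2)[of M R A]
    and H' = hull_admissible(1)[of A M' R', unfolded sets] hull_admissible(2)[of M' R' A]
  have "AE t in ?P. t \<in> ?H \<longrightarrow> t \<in> ?H' \<union> (space ?P - PiE A (\<lambda>_. Q))"
    using H(1) H' QA adm admissible_subset_space[of M R A] M
    by (intro finite_measure.AE_measurable_hull_subset prob_space.finite_measure prob_space_PiM) auto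
  then have 1: "AE t in ?P'. t \<in> ?H \<longrightarrow> t \<in> ?H' \<union> (space ?P - PiE A (\<lambda>_. Q))"
    unfolding P' by (intro AE_uniform_measureI[OF CA]) (auto elim!: eventually_mono)
  have 2: "AE t in ?P'. t \<in> ?H' \<longrightarrow> t \<in> ?H \<union> (space ?P - PiE A (\<lambda>_. Q))"
    using H H'(1) QA adm admissible_subset_space[of M' R' A] M'
    by (intro finite_measure.AE_measurable_hull_subset prob_space.finite_measure prob_space_PiM)
       (auto simp: sets space)
  from 1 2 AE_space[of ?P'] show ?thesis
    unfolding M'_def[symmetric]
  proof eventually_elim
    case (elim t)
    then have t: "t \<in> extensional A" by (auto simp: space_PiM PiE_iff)
    show ?case
    proof
      assume "\<forall>i\<in>A. t i \<in> Q"
      then have "t \<in> PiE A (\<lambda>_. Q)" using t by (simp add: PiE_iff)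
      then have "t \<in> ?H \<longleftrightarrow> t \<in> ?H'" using elim(1,2) by blast
      then show "boltzmann M R t A = boltzmann M' R' t A"
        using t by (simp add: boltzmann_def extensional_restrict indicator_def)
    qed
  qed
qed

text \<open>
  A cluster has bounded extent. If some but not all points lie in \<open>Q m\<close>, then some point outside is
  near one inside, since otherwise the configuration would split. That point lies in \<open>Q (Suc m)\<close>, so
  at least \<open>m + 1\<close> points lie in \<open>Q m\<close> until all points are included.
\<close>

lemma subset_if_far_splits_vanish:
  fixes Q :: "nat \<Rightarrow> 'b set"
  assumes A: "finite A" "a \<in> A" and a: "t a \<in> Q 0" and C: "\<And>i. i \<in> A \<Longrightarrow> t i \<in> C"
    and step: "\<And>m x y. m < card A \<Longrightarrow> x \<in> Q m \<Longrightarrow> y \<in> C \<Longrightarrow> near x y \<Longrightarrow> y \<in> Q (Suc m)"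
    and mono: "\<And>m. Q m \<subseteq> Q (Suc m)"
    and linked: "\<And>X Y. X \<union> Y = A \<Longrightarrow> X \<inter> Y = {} \<Longrightarrow> X \<noteq> {} \<Longrightarrow> Y \<noteq> {} \<Longrightarrow>
      \<exists>i\<in>X. \<exists>j\<in>Y. near (t i) (t j)"
    and "i \<in> A"
  shows "t i \<in> Q (card A)"
proof -
  define X where "X m = {i\<in>A. t i \<in> Q m}" for m
  have "X m = A \<or> m < card (X m)" if "m \<le> card A" for m
    using that
  proof (induction m)
    case 0
    have "a \<in> X 0" using A a by (simp add: X_def)
    then show ?case using A by (auto simp: card_gt_0_iff X_def)
  next
    case (Suc m)
    have sub: "X m \<subseteq> X (Suc m)" using mono by (auto simp: X_def)
    have XA: "X m' \<subseteq> A" for m' by (auto simp: X_def)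
    show ?case
    proof (cases "X m = A")
      case True
      then show ?thesis using sub XA[of "Suc m"] by blast
    next
      case False
      then have m: "m < card (X m)" using Suc by simp
      then have "X m \<noteq> {}" by auto
      then obtain i j where ij: "i \<in> X m" "j \<in> A - X m" "near (t i) (t j)"
        using linked[of "X m" "A - X m"] False XA[of m] by blast
      then have "j \<in> X (Suc m)"
        using step[of m "t i" "t j"] C[of j] Suc.prems by (auto simp: X_def)
      then have "X m \<subset> X (Suc m)" using sub ij(2) by blast
      then have "card (X m) < card (X (Suc m))"
        using finite_subset[OF XA A(1)] by (intro psubset_card_mono)
      then show ?thesis using m by simp
    qed
  qed
  from this[of "card A"] have "X (card A) = A"
    using A card_mono[of A "X (card A)"] by (auto simp: X_def)
  then show ?thesis using \<open>i \<in> A\<close> by (auto simp: X_def)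
qed


lemma AE_cluster_fn_uniform_measure:
  assumes A: "finite A" and M: "prob_space M" and C: "C \<in> sets M" "emeasure M C \<noteq> 0"
    and Q: "Q \<in> sets M" "Q \<subseteq> C"
    and R: "\<forall>x\<in>Q. \<forall>y\<in>Q. R x y \<longleftrightarrow> R' x y"
  shows "AE t in PiM A (\<lambda>_. uniform_measure M C). (\<forall>i\<in>A. t i \<in> Q) \<longrightarrow>
    cluster_fn M R A t = cluster_fn (uniform_measure M C) R' A t"
proof -
  let ?M' = "uniform_measure M C"
  have M': "prob_space ?M'"
    using M C by (intro prob_space_uniform_measure)
      (auto simp: finite_measure.emeasure_eq_measure[OF prob_space.finite_measure])
  interpret U: hard_core ?M' "\<lambda>_ _. True" "\<lambda>_ _. True"
    using M' by (auto simp: hard_core_def hard_core_axioms_def)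
  have "AE t in PiM A (\<lambda>_. ?M'). \<forall>B\<in>Pow A. (\<forall>i\<in>A. t i \<in> Q) \<longrightarrow>
      boltzmann M R t B = boltzmann ?M' R' t B"
  proof (rule AE_finite_allI)
    fix B assume "B \<in> Pow A"
    then have B: "B \<subseteq> A" "finite B" using A by (auto intro: finite_subset)
    from U.AE_PiM_restrict[OF A B(1) AE_boltzmann_uniform_measure[OF B(2) M C Q R]]
    show "AE t in PiM A (\<lambda>_. ?M'). (\<forall>i\<in>A. t i \<in> Q) \<longrightarrow> boltzmann M R t B = boltzmann ?M' R' t B"
      by eventually_elim (use B in \<open>auto simp: boltzmann_restrict\<close>)
  qed (use A in simp)
  then show ?thesis
    unfolding cluster_fn_def by eventually_elim (auto intro: ursell_cong)
qed

text \<open>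
  If a cluster with a point in \<open>W\<close> stays in \<open>Q\<close>, its pinned integral sees \<open>M\<close> and \<open>R\<close> inside \<open>Q\<close> only. Each
  of the \<open>card A\<close> independent points contributes a factor \<open>measure M C\<close> for being conditioned on \<open>C\<close>.
\<close>

lemma pinned_cluster_integral_uniform_measure:
  assumes A: "finite A" "a \<in> A" and M: "prob_space M" and C: "C \<in> sets M" "emeasure M C \<noteq> 0"
    and Q: "Q \<in> sets M" "Q \<subseteq> C" and W: "W \<in> sets M"
    and R: "\<forall>x\<in>Q. \<forall>y\<in>Q. R x y \<longleftrightarrow> R' x y"
    and confined: "AE t in PiM A (\<lambda>_. M). t a \<in> W \<longrightarrow> cluster_fn M R A t \<noteq> 0 \<longrightarrow> (\<forall>i\<in>A. t i \<in> Q)"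
    and confined': "AE t in PiM A (\<lambda>_. uniform_measure M C). t a \<in> W \<longrightarrow>
      cluster_fn (uniform_measure M C) R' A t \<noteq> 0 \<longrightarrow> (\<forall>i\<in>A. t i \<in> Q)"
  shows "(\<integral>t. indicator W (t a) * cluster_fn M R A t \<partial>PiM A (\<lambda>_. M))
    = measure M C ^ card A *
      (\<integral>t. indicator W (t a) * cluster_fn (uniform_measure M C) R' A t \<partial>PiM A (\<lambda>_. uniform_measure M C))"
proof -
  let ?M' = "uniform_measure M C"
  let ?P = "PiM A (\<lambda>_. M)" and ?P' = "PiM A (\<lambda>_. ?M')"
  let ?QA = "PiE A (\<lambda>_. Q)" and ?CA = "PiE A (\<lambda>_. C)"
  interpret M: prob_space M by fact
  interpret P: product_prob_space "\<lambda>_ :: nat. M" ..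
  have P: "prob_space ?P" using M by (rule prob_space_PiM)
  have P': "?P' = uniform_measure ?P ?CA"
    using A(1) M C by (rule PiM_uniform_measure)
  have QA[measurable]: "?QA \<in> sets ?P" using A Q by (intro sets_PiM_I_finite) auto
  have CA[measurable]: "?CA \<in> sets ?P" using A C by (intro sets_PiM_I_finite) auto
  have "emeasure ?P ?CA = ennreal (measure M C ^ card A)"
    using A C by (simp add: P.emeasure_PiM M.emeasure_eq_measure ennreal_power)
  then have mCA: "measure ?P ?CA = measure M C ^ card A" by (simp add: measure_def)
  have "0 < measure M C" using C by (simp add: M.emeasure_eq_measure zero_less_measure_iff)
  then have CA0: "emeasure ?P ?CA \<noteq> 0"
    using \<open>emeasure ?P ?CA = _\<close> by simp
  define g where "g t = indicator ?QA t * (indicator W (t a) * cluster_fn M R A t)" for t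
  have [measurable]: "cluster_fn M R A \<in> borel_measurable ?P" "cluster_fn ?M' R' A \<in> borel_measurable ?P'"
    using A by (auto intro!: measurable_cluster_fn)
  have [measurable]: "(\<lambda>t. t a) \<in> measurable ?P M" "(\<lambda>t. t a) \<in> measurable ?P' ?M'"
    using A by measurable
  note W[measurable]
  have W'[measurable]: "W \<in> sets ?M'" using W by simp
  have g[measurable]: "g \<in> borel_measurable ?P" unfolding g_def by measurable
  then have g'[measurable]: "g \<in> borel_measurable ?P'" unfolding P' by (simp cong: measurable_cong_sets)
  have "(\<integral>t. indicator W (t a) * cluster_fn M R A t \<partial>?P) = (\<integral>t. indicator ?CA t * g t \<partial>?P)"
  proof (rule integral_cong_AE)
    show "AE t in ?P. indicator W (t a) * cluster_fn M R A t = indicator ?CA t * g t"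
      using confined AE_space
    proof eventually_elim
      case (elim t)
      show ?case
      proof (cases "t a \<in> W \<and> cluster_fn M R A t \<noteq> 0")
        case True
        then have "t \<in> ?QA" using elim by (auto simp: space_PiM PiE_iff)
        moreover from this have "t \<in> ?CA" using Q by (auto simp: PiE_iff)
        ultimately show ?thesis by (simp add: g_def)
      qed (auto simp: g_def)
    qed
  qed measurable
  also have "\<dots> = measure M C ^ card A * (\<integral>t. g t \<partial>?P')"
    unfolding P' mCA[symmetric] by (rule integral_uniform_measure[OF P CA CA0 g])
  also have "(\<integral>t. g t \<partial>?P') = (\<integral>t. indicator W (t a) * cluster_fn ?M' R' A t \<partial>?P')"
  proof (rule integral_cong_AE)
    show "AE t in ?P'. g t = indicator W (t a) * cluster_fn ?M' R' A t"
      using confined' AE_cluster_fn_uniform_measure[OF A(1) M C Q R] AE_space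
    proof eventually_elim
      case (elim t)
      then have "t \<in> ?QA \<longleftrightarrow> (\<forall>i\<in>A. t i \<in> Q)" by (auto simp: space_PiM PiE_iff)
      then show ?case using elim by (auto simp: g_def indicator_def)
    qed
  qed measurable
  finally show ?thesis .
qed

section \<open>Copies of a bounded set on the torus\<close>

abbreviation uniform_torus :: "real \<Rightarrow> (real ^ 'd) measure" where
  "uniform_torus n \<equiv> uniform_measure lborel (torus_cube n)"

definition disjoint_copies :: "real \<Rightarrow> (real ^ 'd) set \<Rightarrow> real ^ 'd \<Rightarrow> real ^ 'd \<Rightarrow> bool" where
  "disjoint_copies n S x y \<longleftrightarrow> torus_copy n S x \<inter> torus_copy n S y = {}"

text \<open>
  Comparing coordinates separately, instead of using the Euclidean norm, makes measurability immediate
  and lets a cluster spread from one axis-parallel cube to a larger one.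
\<close>

definition torus_near :: "real \<Rightarrow> real \<Rightarrow> real ^ 'd \<Rightarrow> real ^ 'd \<Rightarrow> bool" where
  "torus_near n r x y \<longleftrightarrow> (\<forall>i. \<exists>z :: int. \<bar>x $ i - y $ i - n * of_int z\<bar> \<le> r)"

definition torus_wrap :: "real \<Rightarrow> real ^ 'd \<Rightarrow> real ^ 'd" where
  "torus_wrap n x = (\<chi> i. x $ i - n * of_int \<lfloor>x $ i / n\<rfloor>)"

lemma sets_torus_cube [measurable]: "torus_cube n \<in> sets borel"
  unfolding torus_cube_def by measurable

lemma prob_space_uniform_torus:
  assumes "n > 0"
  shows "prob_space (uniform_torus n :: (real ^ 'd) measure)"
proof -
  have e: "emeasure lborel (torus_cube n :: (real ^ 'd) set) = ennreal (n ^ CARD('d))"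
    using assms by (intro emeasure_torus_cube) simp
  have "0 < n ^ CARD('d)" using assms by simp
  then show ?thesis
    by (intro prob_space_uniform_measure)
      (simp_all only: e ennreal_eq_0_iff ennreal_neq_top not_le not_False_eq_True infinity_ennreal_def)
qed

lemma measurable_torus_wrap [measurable]: "torus_wrap n \<in> borel_measurable borel"
proof -
  have "(\<lambda>x. torus_wrap n x $ i) \<in> borel_measurable borel" for i
    unfolding torus_wrap_def by simp
  then show ?thesis
    by (subst borel_measurable_euclidean_space) (auto simp: Basis_vec_def inner_axis)
qed

lemma torus_cube_unique_shift:
  fixes w :: "real ^ 'd"
  assumes "n > 0"
  shows "w - (\<chi> i. n * of_int (z $ i)) \<in> torus_cube n \<longleftrightarrow> z = (\<chi> i. \<lfloor>w $ i / n\<rfloor>)"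
proof -
  have "0 \<le> w $ i - n * of_int (z $ i) \<and> w $ i - n * of_int (z $ i) < n \<longleftrightarrow> \<lfloor>w $ i / n\<rfloor> = z $ i" for i
    using assms by (simp add: floor_eq_iff field_simps)
  then show ?thesis by (auto simp: torus_cube_def vec_eq_iff)
qed

lemma emeasure_lborel_shift:
  fixes c :: "'a::euclidean_space"
  assumes "B \<in> sets borel"
  shows "emeasure lborel {x. c + x \<in> B} = emeasure lborel B"
proof -
  have "emeasure (distr lborel borel ((+) c)) B = emeasure lborel ((+) c -` B \<inter> space lborel)"
    using assms by (intro emeasure_distr) auto
  then show ?thesis by (simp add: lborel_distr_plus vimage_def)
qed

text \<open>
  Cut the cube into pieces \<open>X z\<close> according to the lattice vector \<open>z\<close> subtracted after the translation
  by \<open>s\<close>. Each piece is translated rigidly onto \<open>Y z\<close>, and the sets \<open>Y z\<close> again partition the cube,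
  because every vector has exactly one representative in the cube.
\<close>

lemma emeasure_torus_wrap_shift:
  fixes s :: "real ^ 'd"
  assumes n: "n > 0" and B: "B \<in> sets borel"
  shows "emeasure lborel (torus_cube n \<inter> {x. torus_wrap n (s + x) \<in> B}) = emeasure lborel (torus_cube n \<inter> B)"
proof -
  let ?L = "\<lambda>z :: int ^ 'd. (\<chi> i. n * of_int (z $ i)) :: real ^ 'd"
  note B[measurable]
  have wrap: "torus_wrap n w = w - ?L (\<chi> i. \<lfloor>w $ i / n\<rfloor>)" for w :: "real ^ 'd"
    by (simp add: torus_wrap_def vec_eq_iff)
  define X where "X z = {x \<in> torus_cube n. (s - ?L z) + x \<in> torus_cube n \<inter> B}" for z
  define Y where "Y z = {y \<in> torus_cube n \<inter> B. y - (s - ?L z) \<in> torus_cube n}" for z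
  have X_iff: "x \<in> X z \<longleftrightarrow> x \<in> torus_cube n \<and> torus_wrap n (s + x) \<in> B \<and> z = (\<chi> i. \<lfloor>(s + x) $ i / n\<rfloor>)" for x z
    using torus_cube_unique_shift[OF n, of "s + x" z] by (auto simp: X_def wrap algebra_simps)
  have Y_iff: "y \<in> Y z \<longleftrightarrow> y \<in> torus_cube n \<inter> B \<and> - z = (\<chi> i. \<lfloor>(y - s) $ i / n\<rfloor>)" for y z
  proof -
    have "?L (- z) = - ?L z" by (simp add: vec_eq_iff)
    then show ?thesis
      using torus_cube_unique_shift[OF n, of "y - s" "- z"] by (auto simp: Y_def algebra_simps)
  qed
  have [measurable]: "X z \<in> sets borel" "Y z \<in> sets borel" for z
    unfolding X_def Y_def by measurable
  have disj: "disjoint_family X" "disjoint_family Y"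
    unfolding disjoint_family_on_def using X_iff Y_iff by (auto, metis minus_equation_iff)
  have XY: "emeasure lborel (X z) = emeasure lborel (Y z)" for z
  proof -
    have "X z = {x. (s - ?L z) + x \<in> Y z}" by (auto simp: X_def Y_def)
    then show ?thesis using emeasure_lborel_shift[of "Y z" "s - ?L z"] by simp
  qed
  have "torus_cube n \<inter> {x. torus_wrap n (s + x) \<in> B} = (\<Union>z. X z)"
    using X_iff by auto
  moreover have "torus_cube n \<inter> B = (\<Union>z. Y z)"
  proof -
    have "y \<in> Y (- (\<chi> i. \<lfloor>(y - s) $ i / n\<rfloor>))" if "y \<in> torus_cube n \<inter> B" for y
      using that Y_iff by simp
    then show ?thesis using Y_iff by blast
  qed
  ultimately show ?thesis
    using disj by (simp add: emeasure_UN_countable XY)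
qed

lemma distr_torus_wrap_shift:
  fixes s :: "real ^ 'd"
  assumes "n > 0"
  shows "distr (uniform_torus n) (uniform_torus n) (\<lambda>x. torus_wrap n (s + x)) = uniform_torus n"
proof (rule measure_eqI)
  fix B :: "(real ^ 'd) set" assume "B \<in> sets (distr (uniform_torus n) (uniform_torus n) (\<lambda>x. torus_wrap n (s + x)))"
  then have B[measurable]: "B \<in> sets borel" by simp
  have "emeasure (distr (uniform_torus n) (uniform_torus n) (\<lambda>x. torus_wrap n (s + x))) B
      = emeasure (uniform_torus n) {x. torus_wrap n (s + x) \<in> B}"
    by (subst emeasure_distr) (auto simp: vimage_def)
  also have "\<dots> = emeasure (uniform_torus n) B"
    using emeasure_torus_wrap_shift[OF assms B, of s] by simp
  finally show "emeasure (distr (uniform_torus n) (uniform_torus n) (\<lambda>x. torus_wrap n (s + x))) B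
      = emeasure (uniform_torus n) B" .
qed simp

lemma disjoint_copies_iff:
  "disjoint_copies n S x y \<longleftrightarrow> (\<forall>u\<in>S. \<forall>v\<in>S. (x + u, y + v) \<notin> torus_rel n)"
proof -
  have proj: "torus_proj n a = torus_proj n b \<longleftrightarrow> (a, b) \<in> torus_rel n" for a b :: "real ^ 'a"
    unfolding torus_proj_def using eq_equiv_class_iff[OF equiv_torus_rel, of a b n] by simp
  have "disjoint_copies n S x y \<longleftrightarrow> (\<forall>u\<in>S. \<forall>v\<in>S. torus_proj n (x + u) \<noteq> torus_proj n (y + v))"
    unfolding disjoint_copies_def torus_copy_def by blast
  then show ?thesis by (simp only: proj)
qed

lemma disjoint_copies_wrap_shift:
  assumes "n > 0"
  shows "disjoint_copies n S (torus_wrap n (s + x)) (torus_wrap n (s + y)) \<longleftrightarrow> disjoint_copies n S x y"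
proof -
  have "(torus_wrap n w, w) \<in> torus_rel n" for w :: "real ^ 'a"
    unfolding torus_rel_def torus_wrap_def
    by (auto intro!: exI[of _ "\<chi> i. - \<lfloor>w $ i / n\<rfloor>"])
  then have "disjoint_copies n S (torus_wrap n (s + x)) (torus_wrap n (s + y)) \<longleftrightarrow> disjoint_copies n S (s + x) (s + y)"
    unfolding disjoint_copies_def using torus_copy_mod by metis
  also have "\<dots> \<longleftrightarrow> disjoint_copies n S x y"
  proof -
    have "(s + x + u, s + y + v) \<in> torus_rel n \<longleftrightarrow> (x + u, y + v) \<in> torus_rel n" for u v
      by (simp add: torus_rel_def add.assoc)
    then show ?thesis by (simp only: disjoint_copies_iff)
  qed
  finally show ?thesis .
qed

lemma disjoint_copies_if_not_near:
  assumes r: "\<And>u v i. u \<in> S \<Longrightarrow> v \<in> S \<Longrightarrow> \<bar>u $ i - v $ i\<bar> \<le> r" and "\<not> torus_near n r x y"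
  shows "disjoint_copies n S x y"
  unfolding disjoint_copies_iff
proof (intro ballI notI)
  fix u v assume uv: "u \<in> S" "v \<in> S" "(x + u, y + v) \<in> torus_rel n"
  then obtain z :: "int ^ 'a" where z: "\<And>i. (x + u) $ i - (y + v) $ i = n * of_int (z $ i)"
    by (auto simp: torus_rel_def)
  have "\<bar>x $ i - y $ i - n * of_int (z $ i)\<bar> \<le> r" for i
    using z[of i] r[OF uv(2,1), of i] by simp
  then have "torus_near n r x y"
    unfolding torus_near_def by blast
  then show False using assms by simp
qed

text \<open>
  For copies that are close together compared with the side length \<open>n\<close>, wrapping around has no effect,
  so the relation is the same for all large \<open>n\<close>.
\<close>

lemma disjoint_copies_bounded:
  fixes x y :: "real ^ 'd"
  assumes r: "\<And>u v i. u \<in> S \<Longrightarrow> v \<in> S \<Longrightarrow> \<bar>u $ i - v $ i\<bar> \<le> r"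
    and L: "\<And>i. \<bar>x $ i - y $ i\<bar> \<le> L" and n: "L + r < n"
  shows "disjoint_copies n S x y \<longleftrightarrow> (\<forall>u\<in>S. \<forall>v\<in>S. x + u \<noteq> y + v)"
proof -
  have "(x + u, y + v) \<in> torus_rel n \<longleftrightarrow> x + u = y + v" if uv: "u \<in> S" "v \<in> S" for u v
  proof
    assume "(x + u, y + v) \<in> torus_rel n"
    then obtain z :: "int ^ 'd" where z: "\<And>i. (x + u) $ i - (y + v) $ i = n * of_int (z $ i)"
      by (auto simp: torus_rel_def)
    have "z $ i = 0" for i
    proof -
      have "\<bar>n * of_int (z $ i)\<bar> \<le> L + r"
        using z[of i] L[of i] r[OF uv, of i] by simp
      then have "\<bar>n\<bar> * \<bar>of_int (z $ i)\<bar> < n" using n by (simp add: abs_mult)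
      then have "\<bar>n\<bar> * \<bar>of_int (z $ i)\<bar> < \<bar>n\<bar> * 1" by simp
      then have "\<bar>of_int (z $ i)\<bar> < (1 :: real)" by (rule mult_left_less_imp_less) simp
      then show ?thesis by linarith
    qed
    then have "(x + u) $ i = (y + v) $ i" for i using z[of i] by simp
    then show "x + u = y + v" by (simp only: vec_eq_iff) blast
  qed (auto simp: torus_rel_def intro!: exI[of _ 0])
  then show ?thesis by (auto simp: disjoint_copies_iff)
qed

lemma hard_core_torus:
  fixes S :: "(real ^ 'd) set"
  assumes "n > 0" and r: "\<And>u v i. u \<in> S \<Longrightarrow> v \<in> S \<Longrightarrow> \<bar>u $ i - v $ i\<bar> \<le> r"
  shows "hard_core (uniform_torus n) (disjoint_copies n S) (torus_near n r)"
proof -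
  interpret prob_space "uniform_torus n :: (real ^ 'd) measure"
    using assms(1) by (rule prob_space_uniform_torus)
  show ?thesis
  proof
    have nth: "(\<lambda>x :: real ^ 'd. x $ i) \<in> borel_measurable borel" for i by measurable
    have [measurable]: "(\<lambda>p :: (real ^ 'd) \<times> (real ^ 'd). fst p $ i) \<in> borel_measurable (borel \<Otimes>\<^sub>M borel)" for i
      using measurable_compose[OF measurable_fst nth] .
    have [measurable]: "(\<lambda>p :: (real ^ 'd) \<times> (real ^ 'd). snd p $ i) \<in> borel_measurable (borel \<Otimes>\<^sub>M borel)" for i
      using measurable_compose[OF measurable_snd nth] .
    have "Measurable.pred (borel \<Otimes>\<^sub>M borel) (\<lambda>(x :: real ^ 'd, y). torus_near n r x y)"
      unfolding torus_near_def by measurable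
    then show "Measurable.pred (uniform_torus n \<Otimes>\<^sub>M uniform_torus n) (\<lambda>(x :: real ^ 'd, y). torus_near n r x y)"
      by (simp cong: measurable_cong_sets sets_pair_measure_cong)
    fix x y :: "real ^ 'd" assume "\<not> torus_near n r x y"
    then have "disjoint_copies n S x y" using r by (rule disjoint_copies_if_not_near[rotated])
    then show "disjoint_copies n S x y \<and> disjoint_copies n S y x"
      by (auto simp: disjoint_copies_def Int_commute)
  qed
qed

lemma measure_uniform_torus:
  assumes "n > 0" "B \<in> sets borel" "B \<subseteq> torus_cube n"
  shows "measure (uniform_torus n :: (real ^ 'd) measure) B = measure lborel B / n ^ CARD('d)"
proof -
  have "emeasure lborel (torus_cube n :: (real ^ 'd) set) = ennreal (n ^ CARD('d))"
    using assms by (intro emeasure_torus_cube) simp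
  moreover have "torus_cube n \<inter> B = B" using assms by auto
  ultimately show ?thesis
    using assms by (subst measure_uniform_measure) (auto simp: measure_def not_le)
qed

lemma uniform_measure_subset:
  assumes "C \<in> sets M" "C' \<in> sets M" "C' \<subseteq> C" "emeasure M C \<noteq> \<infinity>" "emeasure M C' \<noteq> 0"
  shows "uniform_measure (uniform_measure M C) C' = uniform_measure M C'"
proof (rule measure_eqI)
  fix B assume "B \<in> sets (uniform_measure (uniform_measure M C) C')"
  then have B: "B \<in> sets M" by simp
  have eq: "C \<inter> (C' \<inter> B) = C' \<inter> B" "C \<inter> C' = C'" using assms by auto
  have le: "emeasure M C' \<le> emeasure M C" "emeasure M (C' \<inter> B) \<le> emeasure M C"
    using assms B by (auto intro!: emeasure_mono)
  obtain c c' b where "emeasure M C = ennreal c" "emeasure M C' = ennreal c'" "emeasure M (C' \<inter> B) = ennreal b"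
    "0 \<le> c" "0 \<le> c'" "0 \<le> b"
    using le assms(4) by (cases "emeasure M C"; cases "emeasure M C'"; cases "emeasure M (C' \<inter> B)") (auto simp: top_unique)
  moreover from this have "0 < c'" "0 < c" using assms(5) le by (auto simp: less_le)
  ultimately show "emeasure (uniform_measure (uniform_measure M C) C') B = emeasure (uniform_measure M C') B"
    using assms B by (simp add: eq divide_ennreal)
qed simp

text \<open>
  Away from the faces of the fundamental cube, the integer in the definition of \<^const>\<open>torus_near\<close> can only
  be 0: any other lattice translate of \<open>y\<close> lies beyond a face.
\<close>

lemma torus_near_no_wrap:
  fixes x y :: "real ^ 'd"
  assumes near: "torus_near n r x y" and y: "y \<in> torus_cube n" and r: "r > 0"
    and x: "\<And>i. r \<le> x $ i \<and> x $ i < n - r"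
  shows "\<bar>x $ i - y $ i\<bar> \<le> r"
proof -
  obtain z :: int where z: "\<bar>x $ i - y $ i - n * of_int z\<bar> \<le> r"
    using near by (auto simp: torus_near_def)
  have yi: "0 \<le> y $ i" "y $ i < n" using y by (auto simp: torus_cube_def)
  have "n * of_int z < n" "- n < n * of_int z"
    using z x[of i] yi unfolding abs_le_iff by linarith+
  then have "n * of_int z < n * 1" "n * (- 1) < n * of_int z" by (simp_all only: mult_1_right mult_minus_right)
  then have "of_int z < (1 :: real)" "-1 < (of_int z :: real)"
    using yi by (auto simp only: mult_less_cancel_left)
  then have "z = 0" by linarith
  then show ?thesis using z by simp
qed

definition closed_cube :: "real \<Rightarrow> real \<Rightarrow> (real ^ 'd) set" where
  "closed_cube l u = {x. \<forall>i. l \<le> x $ i \<and> x $ i \<le> u}"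

lemma sets_closed_cube [measurable]: "closed_cube l u \<in> sets borel"
  unfolding closed_cube_def by measurable

lemma closed_cube_subset_torus_cube:
  assumes "0 \<le> l" "u < n"
  shows "closed_cube l u \<subseteq> torus_cube n"
  using assms by (auto simp: closed_cube_def torus_cube_def intro: order.trans le_less_trans)

lemma measure_closed_cube_pos:
  assumes "l < u"
  shows "0 < measure lborel (closed_cube l u :: (real ^ 'd) set)"
proof -
  have "closed_cube l u = cbox (\<chi> i. l) ((\<chi> i. u) :: real ^ 'd)"
    by (auto simp: closed_cube_def mem_box_cart)
  moreover have "0 < measure lborel (cbox (\<chi> i. l) ((\<chi> i. u) :: real ^ 'd))"
    using assms by (intro content_pos_lt) (auto simp: Basis_vec_def inner_axis)
  ultimately show ?thesis by simp
qed

text \<open>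
  A cluster with one point in the cube of corners \<open>l\<close> and \<open>u\<close> grows by at most \<open>r\<close> per point. The
  bounds on \<open>l\<close> and \<open>n\<close> leave room for \<open>card A\<close> such steps and a further margin \<open>r\<close>, so the cluster cannot
  reach around the torus.
\<close>

lemma AE_cluster_fn_confined:
  fixes S :: "(real ^ 'd) set"
  assumes r: "r > 0" "\<And>u v i. u \<in> S \<Longrightarrow> v \<in> S \<Longrightarrow> \<bar>u $ i - v $ i\<bar> \<le> r"
    and A: "finite A" "a \<in> A" and l: "(1 + real (card A)) * r \<le> l" and n: "u + (1 + real (card A)) * r < n"
    and lu: "l \<le> u"
  shows "AE t in PiM A (\<lambda>_. uniform_torus n). t a \<in> closed_cube l u \<longrightarrow>
    cluster_fn (uniform_torus n) (disjoint_copies n S) A t \<noteq> 0 \<longrightarrow>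
    (\<forall>i\<in>A. t i \<in> closed_cube (l - real (card A) * r) (u + real (card A) * r))"
proof -
  let ?M = "uniform_torus n :: (real ^ 'd) measure"
  define Q :: "nat \<Rightarrow> (real ^ 'd) set" where "Q m = closed_cube (l - real m * r) (u + real m * r)" for m
  have "0 \<le> real (card A) * r" using r by simp
  then have n0: "n > 0" using l n lu r(1) unfolding distrib_right by linarith
  interpret hard_core ?M "disjoint_copies n S" "torus_near n r"
    using n0 r(2) by (rule hard_core_torus)
  have step: "y \<in> Q (Suc m)" if m: "m < card A" and x: "x \<in> Q m" and y: "y \<in> torus_cube n"
    and near: "torus_near n r x y" for m x y
  proof -
    have "real m * r \<le> real (card A) * r" using m r(1) by (intro mult_right_mono) auto
    moreover have xi: "l - real m * r \<le> x $ i \<and> x $ i \<le> u + real m * r" for i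
      using x by (simp add: Q_def closed_cube_def)
    ultimately have "r \<le> x $ i \<and> x $ i < n - r" for i
      using xi[of i] l n r(1) unfolding distrib_right mult_1 by (intro conjI; linarith)
    from torus_near_no_wrap[OF near y r(1) this] have "\<bar>x $ i - y $ i\<bar> \<le> r" for i .
    then have "l - real m * r - r \<le> y $ i \<and> y $ i \<le> u + real m * r + r" for i
      using xi[of i] by (smt (verit))
    then show ?thesis by (simp add: Q_def closed_cube_def algebra_simps)
  qed
  have mono: "Q m \<subseteq> Q (Suc m)" for m
    using r(1) by (auto simp: Q_def closed_cube_def algebra_simps intro: order.trans add_increasing)
  have "emeasure lborel (torus_cube n :: (real ^ 'd) set) = ennreal (n ^ CARD('d))"
    using n0 by (intro emeasure_torus_cube) simp
  then have "AE x in ?M. x \<in> torus_cube n"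
    using n0 by (intro AE_uniform_measureI) auto
  then have "AE t in PiM A (\<lambda>_. ?M). \<forall>i\<in>A. t i \<in> torus_cube n"
    using A(1) prob_space_axioms by (intro AE_finite_allI AE_PiM_component) auto
  then show ?thesis
    using AE_cluster_fn_eq_0[OF A(1)]
  proof eventually_elim
    case (elim t)
    show ?case
    proof (intro impI ballI)
      fix i assume W: "t a \<in> closed_cube l u" and nz: "cluster_fn ?M (disjoint_copies n S) A t \<noteq> 0" and i: "i \<in> A"
      have "t i \<in> Q (card A)"
      proof (rule subset_if_far_splits_vanish[where Q = Q and C = "torus_cube n" and near = "torus_near n r" and a = a])
        show "\<exists>i\<in>X. \<exists>j\<in>Y. torus_near n r (t i) (t j)"
          if "X \<union> Y = A" "X \<inter> Y = {}" "X \<noteq> {}" "Y \<noteq> {}" for X Y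
          using elim(2) nz that by blast
      qed (use A W elim(1) step mono i in \<open>auto simp: Q_def\<close>)
      then show "t i \<in> closed_cube (l - real (card A) * r) (u + real (card A) * r)" by (simp add: Q_def)
    qed
  qed
qed

text \<open>
  The rescaled cluster integral is proportional to the volume \<open>n ^ CARD('d)\<close> for all sides beyond \<open>n0\<close>. By
  translation invariance one point may be pinned to a unit cube \<open>W\<close>. The whole cluster then lies in a cube
  \<open>Q\<close> that fits into the torus of side \<open>n0\<close>, where side lengths \<open>n\<close> and \<open>n0\<close> give the same relation between
  copies. Pinning costs the factor \<open>measure lborel W / n ^ CARD('d)\<close>, which produces the volume.
\<close>

lemma cluster_integral_scaling:
  fixes S :: "(real ^ 'd) set"
  assumes r: "r > 0" "\<And>u v i. u \<in> S \<Longrightarrow> v \<in> S \<Longrightarrow> \<bar>u $ i - v $ i\<bar> \<le> r"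
    and A: "finite A" "A \<noteq> {}"
    and n0: "n0 = 2 * (1 + real (card A)) * r + 2" and n: "n0 \<le> n"
  shows "n ^ (CARD('d) * card A) * cluster_integral (uniform_torus n) (disjoint_copies n S) A / n ^ CARD('d)
    = n0 ^ (CARD('d) * card A) * cluster_integral (uniform_torus n0) (disjoint_copies n0 S) A / n0 ^ CARD('d)"
proof -
  define k where "k = real (card A)"
  define l where "l = (1 + k) * r"
  define W :: "(real ^ 'd) set" where "W = closed_cube l (l + 1)"
  define Q :: "(real ^ 'd) set" where "Q = closed_cube (l - k * r) (l + 1 + k * r)"
  define C :: "(real ^ 'd) set" where "C = torus_cube n0"
  let ?M = "uniform_torus n :: (real ^ 'd) measure"
  let ?N = "uniform_torus n0 :: (real ^ 'd) measure"
  let ?J = "\<lambda>n a. \<integral>t. indicator W (t a) * cluster_fn (uniform_torus n) (disjoint_copies n S) A t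
    \<partial>PiM A (\<lambda>_. uniform_torus n)"
  have k: "k \<ge> 1" using A by (simp add: k_def Suc_le_eq card_gt_0_iff)
  have kr: "0 \<le> k * r" using k r by simp
  have n0_eq: "n0 = 2 * l + 2" by (simp add: n0 l_def k_def algebra_simps)
  have l: "l = r + k * r" by (simp add: l_def algebra_simps)
  have pos: "n0 > 0" "n > 0" using n0_eq l kr r n by auto
  obtain a where a: "a \<in> A" using A by blast
  have QC: "Q \<subseteq> C"
    unfolding Q_def C_def using kr r(1) n0_eq l by (intro closed_cube_subset_torus_cube) linarith+
  have WC: "W \<subseteq> torus_cube m" if "n0 \<le> m" for m
    unfolding W_def using kr r(1) n0_eq l that by (intro closed_cube_subset_torus_cube) linarith+
  have cube: "emeasure lborel (torus_cube m :: (real ^ 'd) set) = ennreal (m ^ CARD('d))" if "m > 0" for m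
    using that by (intro emeasure_torus_cube) simp
  have cube_subset: "C \<subseteq> torus_cube n" using n by (auto simp: C_def torus_cube_def intro: less_le_trans)
  have M0: "uniform_measure ?M C = ?N"
    unfolding C_def by (rule uniform_measure_subset)
      (use cube_subset cube[OF pos(1)] cube[OF pos(2)] pos in \<open>auto simp: C_def not_le\<close>)
  \<comment> \<open>Below \<open>W\<close> there is room \<open>l\<close> for \<open>card A\<close> steps of length \<open>r\<close> and a margin \<open>r\<close>; since \<open>n0 = 2 * l + 2\<close>, there is as much above it.\<close>
  have conf: "AE t in PiM A (\<lambda>_. uniform_torus m). t a \<in> W \<longrightarrow>
      cluster_fn (uniform_torus m) (disjoint_copies m S) A t \<noteq> 0 \<longrightarrow> (\<forall>i\<in>A. t i \<in> Q)" if "n0 \<le> m" for m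
    unfolding W_def Q_def k_def
  proof (rule AE_cluster_fn_confined[OF r A(1) a])
    show "(1 + real (card A)) * r \<le> l" by (simp add: l_def k_def)
    show "l + 1 + (1 + real (card A)) * r < m" using that n0_eq unfolding l_def k_def by linarith
  qed simp_all
  have same_R: "\<forall>x\<in>Q. \<forall>y\<in>Q. disjoint_copies n S x y \<longleftrightarrow> disjoint_copies n0 S x y"
  proof (intro ballI)
    fix x y assume "x \<in> Q" "y \<in> Q"
    then have d: "\<bar>x $ i - y $ i\<bar> \<le> 1 + 2 * (k * r)" for i
      unfolding Q_def closed_cube_def by (smt (verit) mem_Collect_eq)
    have "1 + 2 * (k * r) + r < n0" using n0_eq l kr r by simp
    then show "disjoint_copies n S x y \<longleftrightarrow> disjoint_copies n0 S x y"
      using disjoint_copies_bounded[of S r x y, OF r(2) d] n by simp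
  qed
  have mC: "measure ?M C = n0 ^ CARD('d) / n ^ CARD('d)"
    using measure_uniform_torus[OF pos(2), of C] cube_subset cube[OF pos(1)] pos
    by (simp add: C_def measure_def)
  have pinned: "cluster_integral (uniform_torus m) (disjoint_copies m S) A * (measure lborel W / m ^ CARD('d))
      = ?J m a" if m: "n0 \<le> m" for m
  proof -
    have m0: "m > 0" using m pos by simp
    interpret m: hard_core "uniform_torus m :: (real ^ 'd) measure" "disjoint_copies m S" "torus_near m r"
      using m0 r(2) by (rule hard_core_torus)
    have T: "(\<lambda>(s, x). torus_wrap m (s + x)) \<in> measurable (uniform_torus m \<Otimes>\<^sub>M uniform_torus m)
        (uniform_torus m :: (real ^ 'd) measure)"
    proof -
      have "(\<lambda>(s, x). torus_wrap m (s + x)) \<in> measurable (borel \<Otimes>\<^sub>M borel) (borel :: (real ^ 'd) measure)"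
        by measurable
      then show ?thesis by (simp cong: measurable_cong_sets sets_pair_measure_cong)
    qed
    have "cluster_integral (uniform_torus m) (disjoint_copies m S) A * measure (uniform_torus m) W = ?J m a"
    proof (rule m.cluster_integral_pinned[OF A(1) a _ T])
      show "distr (uniform_torus m) (uniform_torus m) (\<lambda>s. torus_wrap m (s + x)) = uniform_torus m" for x :: "real ^ 'd"
        using distr_torus_wrap_shift[OF m0, of x] by (simp add: add.commute)
      show "disjoint_copies m S (torus_wrap m (s + x)) (torus_wrap m (s + y)) \<longleftrightarrow> disjoint_copies m S x y" for s x y
        using m0 by (rule disjoint_copies_wrap_shift)
    qed (auto simp: W_def distr_torus_wrap_shift[OF m0])
    then show ?thesis using measure_uniform_torus[OF m0 _ WC[OF m]] by (simp add: W_def)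
  qed
  have "?J n a = measure ?M C ^ card A *
      (\<integral>t. indicator W (t a) * cluster_fn (uniform_measure ?M C) (disjoint_copies n0 S) A t
        \<partial>PiM A (\<lambda>_. uniform_measure ?M C))"
  proof (rule pinned_cluster_integral_uniform_measure[OF A(1) a, where Q = Q])
    show "prob_space ?M" using pos by (intro prob_space_uniform_torus)
    show "emeasure ?M C \<noteq> 0"
      using mC pos by (auto simp: measure_def)
    show "AE t in PiM A (\<lambda>_. uniform_measure ?M C). t a \<in> W \<longrightarrow>
        cluster_fn (uniform_measure ?M C) (disjoint_copies n0 S) A t \<noteq> 0 \<longrightarrow> (\<forall>i\<in>A. t i \<in> Q)"
      unfolding M0 by (rule conf) simp
  qed (use QC same_R conf[OF n] in \<open>auto simp: C_def W_def Q_def\<close>)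
  then have "?J n a = (n0 ^ CARD('d) / n ^ CARD('d)) ^ card A * ?J n0 a"
    unfolding M0 mC .
  then have "cluster_integral (uniform_torus n) (disjoint_copies n S) A * (measure lborel W / n ^ CARD('d))
      = (n0 ^ CARD('d) / n ^ CARD('d)) ^ card A *
        (cluster_integral (uniform_torus n0) (disjoint_copies n0 S) A * (measure lborel W / n0 ^ CARD('d)))"
    by (simp only: pinned[OF n] pinned[OF order.refl])
  moreover have "measure lborel W > 0" unfolding W_def by (rule measure_closed_cube_pos) simp
  ultimately show ?thesis
    using pos by (simp add: power_mult field_simps)
qed

lemma p_disjoint_eq_outer_prob:
  "p_disjoint S k n = outer_prob (uniform_torus n) (disjoint_copies n S) {..<k}"
  unfolding p_disjoint_def outer_prob_def random_shifts_def disjoint_copies_event_def admissible_def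
    disjoint_copies_def by (simp only: Ball_def lessThan_iff)

lemma bounded_vec_differences:
  fixes S :: "(real ^ 'd) set"
  assumes "bounded S"
  obtains r where "r > 0" "\<And>u v i. u \<in> S \<Longrightarrow> v \<in> S \<Longrightarrow> \<bar>u $ i - v $ i\<bar> \<le> r"
proof -
  obtain b where b: "b > 0" "\<And>x. x \<in> S \<Longrightarrow> norm x \<le> b"
    using assms bounded_pos by metis
  have "\<bar>u $ i - v $ i\<bar> \<le> 2 * b" if "u \<in> S" "v \<in> S" for u v i
    using component_le_norm_cart[of u i] component_le_norm_cart[of v i] b(2)[OF that(1)] b(2)[OF that(2)] by linarith
  then show ?thesis using b(1) by (intro that[of "2 * b"]) auto
qed

theorem theorem5p2:
  fixes S :: "(real ^ 'd) set"
  assumes "bounded S" and "S \<in> sets lebesgue"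
  shows "\<exists>P :: nat \<Rightarrow> real poly.
           (\<forall>k. \<forall>\<^sub>F n in at_top.
              n ^ (CARD('d) * k) * p_disjoint S k n = poly (P k) (n ^ CARD('d))) \<and>
           binomial_type (\<lambda>k. smult (1 / fact k) (P k))"
proof -
  obtain r where r: "r > 0" "\<And>u v i. u \<in> S \<Longrightarrow> v \<in> S \<Longrightarrow> \<bar>u $ i - v $ i\<bar> \<le> r"
    using bounded_vec_differences[OF assms(1)] by blast
  \<comment> \<open>Side lengths from which on clusters of \<open>j\<close> copies cannot wrap around the torus.\<close>
  define N where "N j = 2 * (1 + real j) * r + 2" for j
  define q where "q j n = n ^ (CARD('d) * j) * cluster_integral (uniform_torus n) (disjoint_copies n S) {..<j}" for j n
  define c where "c j = q j (N j) / N j ^ CARD('d)" for j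
  define F where "F k n = n ^ (CARD('d) * k) * p_disjoint S k n" for k n
  have ev_q: "\<forall>\<^sub>F n in at_top. q (Suc i) n = c (Suc i) * n ^ CARD('d)" for i
    using eventually_ge_at_top[of "N (Suc i)"] eventually_gt_at_top[of 0]
  proof eventually_elim
    case (elim n)
    have "{..<Suc i} \<noteq> {}" "N (Suc i) = 2 * (1 + real (card {..<Suc i})) * r + 2" by (auto simp: N_def)
    from cluster_integral_scaling[OF r finite_lessThan this elim(1)]
    have "q (Suc i) n / n ^ CARD('d) = c (Suc i)"
      unfolding q_def c_def card_lessThan .
    then show ?case using elim(2) by (simp add: field_simps)
  qed
  have rec: "\<forall>\<^sub>F n in at_top. F (Suc k) n = (\<Sum>i\<le>k. real (k choose i) * q (Suc i) n * F (k - i) n)" for k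
    using eventually_gt_at_top[of 0]
  proof eventually_elim
    case (elim n)
    interpret hard_core "uniform_torus n :: (real ^ 'd) measure" "disjoint_copies n S" "torus_near n r"
      using elim r(2) by (rule hard_core_torus)
    show ?case
      unfolding F_def q_def p_disjoint_eq_outer_prob outer_prob_Suc sum_distrib_left
    proof (rule sum.cong[OF refl])
      fix i assume "i \<in> {..k}"
      then have "CARD('d) * Suc k = CARD('d) * Suc i + CARD('d) * (k - i)"
        by (simp flip: distrib_left)
      then have "n ^ (CARD('d) * Suc k) = n ^ (CARD('d) * Suc i) * n ^ (CARD('d) * (k - i))"
        by (simp only: power_add)
      then show "n ^ (CARD('d) * Suc k) * (real (k choose i) *
            cluster_integral (uniform_torus n) (disjoint_copies n S) {..<Suc i} *
            outer_prob (uniform_torus n) (disjoint_copies n S) {..<k - i})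
          = real (k choose i) *
            (n ^ (CARD('d) * Suc i) * cluster_integral (uniform_torus n) (disjoint_copies n S) {..<Suc i}) *
            (n ^ (CARD('d) * (k - i)) * outer_prob (uniform_torus n) (disjoint_copies n S) {..<k - i})"
        by (simp only: ac_simps)
    qed
  qed
  have "\<forall>\<^sub>F n in at_top. F k n = poly (cluster_poly c k) (n ^ CARD('d))" for k
  proof (induction k rule: less_induct)
    case (less k)
    show ?case
    proof (cases k)
      case 0
      have "\<forall>\<^sub>F n in at_top. F 0 n = 1"
        using eventually_gt_at_top[of 0]
      proof eventually_elim
        case (elim n)
        interpret hard_core "uniform_torus n :: (real ^ 'd) measure" "disjoint_copies n S" "torus_near n r"
          using elim r(2) by (rule hard_core_torus)
        show ?case by (simp add: F_def p_disjoint_eq_outer_prob outer_prob_empty)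
      qed
      then show ?thesis using 0 by simp
    next
      case (Suc j)
      have "\<forall>\<^sub>F n in at_top. \<forall>i\<in>{..j}. q (Suc i) n = c (Suc i) * n ^ CARD('d)"
        by (intro eventually_ball_finite ballI ev_q) simp
      moreover have "\<forall>\<^sub>F n in at_top. \<forall>i\<in>{..j}. F (j - i) n = poly (cluster_poly c (j - i)) (n ^ CARD('d))"
        by (intro eventually_ball_finite ballI less) (auto simp: Suc)
      ultimately have "\<forall>\<^sub>F n in at_top. F (Suc j) n = poly (cluster_poly c (Suc j)) (n ^ CARD('d))"
        using rec[of j]
        by eventually_elim (auto simp: poly_sum intro!: sum.cong)
      then show ?thesis by (simp only: Suc)
    qed
  qed
  then show ?thesis
    using binomial_type_cluster_poly[of c] unfolding F_def by blast
qed

end
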